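(* Let $G$ be a group and $R,S,T$ normal subgroups of $G$. Put ${\bf r}=(R-1)\mathbb Z[G]$, ${\bf s}=(S-1)\mathbb Z[G]$, ${\bf t}=(T-1)\mathbb Z[G]$. Then $$D\bigl(G,\ {\bf r}{\bf s}+{\bf s}{\bf r}+({\bf r}\cap {\bf s}){\bf t}+{\bf t}({\bf r}\cap {\bf s})\bigr)=[R,S]\,[R\cap S,T].$$
   Context: $\mathbb Z[G]$ is the integral group ring of $G$. For a normal subgroup $N$ of $G$, $(N-1)\mathbb Z[G]$ is the two-sided ideal of $\mathbb Z[G]$ generated by all $x-1$, $x\in N$ (the kernel of $\mathbb Z[G]\to\mathbb Z[G/N]$). For a two-sided ideal ${\bf a}$ of $\mathbb Z[G]$, $D(G,{\bf a}):=G\cap(1+{\bf a})=\{g\in G: g-1\in{\bf a}\}$. The product ${\bf a}{\bf b}$ of ideals is the additive subgroup generated by products $ab$ with $a\in{\bf a}$, $b\in{\bf b}$. $[A,B]$ denotes the commutator subgroup of the subgroups $A,B$ of $G$. *)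

theory Defs
  imports "HOL-Algebra.Algebra"
begin

text \<open>
  An element of the integral group ring is a finitely supported function into the integers whose
  support lies in the carrier; \<open>frag_of g\<close> is the basis element given by \<open>g\<close>.  The product is the
  bilinear extension of the group operation.
\<close>

definition group_ring :: "('a, 'b) monoid_scheme \<Rightarrow> ('a \<Rightarrow>\<^sub>0 int) ring" where
  "group_ring G =
    \<lparr>carrier = {u. Poly_Mapping.keys u \<subseteq> carrier G},
     monoid.mult = (\<lambda>u v. frag_extend (\<lambda>x. frag_extend (\<lambda>y. frag_of (x \<otimes>\<^bsub>G\<^esub> y)) v) u),
     one = frag_of \<one>\<^bsub>G\<^esub>,
     ring.zero = 0,
     ring.add = (+)\<rparr>"

definition relative_augmentation_ideal ::
    "('a, 'b) monoid_scheme \<Rightarrow> 'a set \<Rightarrow> ('a \<Rightarrow>\<^sub>0 int) set" where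
  "relative_augmentation_ideal G N =
    Idl\<^bsub>group_ring G\<^esub> {frag_of x - frag_of \<one>\<^bsub>G\<^esub> | x. x \<in> N}"

definition ideal_subgroup ::
    "('a, 'b) monoid_scheme \<Rightarrow> ('a \<Rightarrow>\<^sub>0 int) set \<Rightarrow> 'a set" where
  "ideal_subgroup G \<aa> = {g \<in> carrier G. frag_of g - frag_of \<one>\<^bsub>G\<^esub> \<in> \<aa>}"

text \<open>For \<open>A = B\<close> this is \<^term>\<open>derived G A\<close>, and the same form of commutator is used.\<close>

definition commutator_subgroup ::
    "('a, 'b) monoid_scheme \<Rightarrow> 'a set \<Rightarrow> 'a set \<Rightarrow> 'a set" where
  "commutator_subgroup G A B =
    generate G (\<Union>a\<in>A. \<Union>b\<in>B. {a \<otimes>\<^bsub>G\<^esub> b \<otimes>\<^bsub>G\<^esub> inv\<^bsub>G\<^esub> a \<otimes>\<^bsub>G\<^esub> inv\<^bsub>G\<^esub> b})"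

lemma commutator_subgroup_self: "commutator_subgroup G A A = derived G A"
  by (simp add: commutator_subgroup_def derived_def)

lemma group_ring_simps [simp]:
  "carrier (group_ring G) = {u. Poly_Mapping.keys u \<subseteq> carrier G}"
  "u \<otimes>\<^bsub>group_ring G\<^esub> v =
     frag_extend (\<lambda>x. frag_extend (\<lambda>y. frag_of (x \<otimes>\<^bsub>G\<^esub> y)) v) u"
  "\<one>\<^bsub>group_ring G\<^esub> = frag_of \<one>\<^bsub>G\<^esub>"
  "\<zero>\<^bsub>group_ring G\<^esub> = 0"
  "u \<oplus>\<^bsub>group_ring G\<^esub> v = u + v"
  by (simp_all add: group_ring_def)

lemma frag_extend_fun_add:
  "frag_extend (\<lambda>x. f x + g x) u = frag_extend f u + frag_extend g u"
  by (simp add: frag_extend_def frag_cmul_distrib2 sum.distrib)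

lemma frag_extend_fun_diff:
  "frag_extend (\<lambda>x. f x - g x) u = frag_extend f u - frag_extend g u"
  using frag_extend_fun_add[of "\<lambda>x. f x - g x" g u] by simp

lemma frag_extend_fun_0: "frag_extend (\<lambda>x. 0) u = 0"
  by (simp add: frag_extend_eq_0)

lemma group_ring_closed:
  assumes "group G" "Poly_Mapping.keys u \<subseteq> carrier G" "Poly_Mapping.keys v \<subseteq> carrier G"
  shows "Poly_Mapping.keys (u \<otimes>\<^bsub>group_ring G\<^esub> v) \<subseteq> carrier G"
proof -
  interpret group G by fact
  have "Poly_Mapping.keys (frag_extend (\<lambda>y. frag_of (x \<otimes>\<^bsub>G\<^esub> y)) v) \<subseteq> carrier G"
    if "x \<in> carrier G" for x
    using keys_frag_extend[of "\<lambda>y. frag_of (x \<otimes>\<^bsub>G\<^esub> y)" v] assms(3) that by fastforce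
  then show ?thesis
    using keys_frag_extend[of "\<lambda>x. frag_extend (\<lambda>y. frag_of (x \<otimes>\<^bsub>G\<^esub> y)) v" u] assms(2)
    unfolding group_ring_simps by blast
qed

lemma group_ring_assoc:
  assumes "group G" "Poly_Mapping.keys u \<subseteq> carrier G" "Poly_Mapping.keys v \<subseteq> carrier G"
    "Poly_Mapping.keys w \<subseteq> carrier G"
  shows "(u \<otimes>\<^bsub>group_ring G\<^esub> v) \<otimes>\<^bsub>group_ring G\<^esub> w =
         u \<otimes>\<^bsub>group_ring G\<^esub> (v \<otimes>\<^bsub>group_ring G\<^esub> w)"
proof -
  interpret group G by fact
  show ?thesis
    using assms(2)
  proof (induction u rule: frag_induction)
    case (one x)
    then have x: "x \<in> carrier G" by simp
    show ?case
      using assms(3)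
    proof (induction v rule: frag_induction)
      case (one y)
      then have y: "y \<in> carrier G" by simp
      show ?case
        using assms(4)
        by (induction w rule: frag_induction) (simp_all add: frag_extend_diff x y m_assoc)
    qed (simp_all add: frag_extend_diff frag_extend_fun_diff frag_extend_fun_0)
  qed (simp_all add: frag_extend_diff)
qed

lemma ring_group_ring:
  assumes "group G"
  shows "ring (group_ring G)"
proof -
  interpret group G by fact
  show ?thesis
  proof (rule ringI)
    show "abelian_group (group_ring G)"
    proof (rule abelian_groupI)
      show "\<exists>y\<in>carrier (group_ring G). y \<oplus>\<^bsub>group_ring G\<^esub> x = \<zero>\<^bsub>group_ring G\<^esub>"
        if "x \<in> carrier (group_ring G)" for x
        using that by (intro bexI[of _ "- x"]) auto
      show "x \<oplus>\<^bsub>group_ring G\<^esub> y \<in> carrier (group_ring G)"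
        if "x \<in> carrier (group_ring G)" "y \<in> carrier (group_ring G)" for x y
        using that Poly_Mapping.keys_add[of x y] by auto
    qed (auto simp: algebra_simps)
    show "Group.monoid (group_ring G)"
    proof
      fix x y z
      assume x: "x \<in> carrier (group_ring G)"
      show "\<one>\<^bsub>group_ring G\<^esub> \<otimes>\<^bsub>group_ring G\<^esub> x = x"
      proof -
        have "frag_extend (\<lambda>y. frag_of (\<one>\<^bsub>G\<^esub> \<otimes>\<^bsub>G\<^esub> y)) x = frag_extend frag_of x"
          using x by (intro frag_extend_eq) auto
        then show ?thesis by (simp flip: frag_expansion)
      qed
      show "x \<otimes>\<^bsub>group_ring G\<^esub> \<one>\<^bsub>group_ring G\<^esub> = x"
      proof -
        have "frag_extend (\<lambda>y. frag_of (y \<otimes>\<^bsub>G\<^esub> \<one>\<^bsub>G\<^esub>)) x = frag_extend frag_of x"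
          using x by (intro frag_extend_eq) auto
        then show ?thesis by (simp flip: frag_expansion)
      qed
      assume y: "y \<in> carrier (group_ring G)"
      show "x \<otimes>\<^bsub>group_ring G\<^esub> y \<in> carrier (group_ring G)"
        using group_ring_closed[OF assms] x y by (simp only: group_ring_simps mem_Collect_eq)
      assume z: "z \<in> carrier (group_ring G)"
      show "x \<otimes>\<^bsub>group_ring G\<^esub> y \<otimes>\<^bsub>group_ring G\<^esub> z =
            x \<otimes>\<^bsub>group_ring G\<^esub> (y \<otimes>\<^bsub>group_ring G\<^esub> z)"
        using group_ring_assoc[OF assms] x y z by (simp only: group_ring_simps mem_Collect_eq)
    qed simp
  qed (simp_all add: frag_extend_add frag_extend_fun_add)
qed

end

theory Submission
  imports Defs
begin

text \<open>
  Write \<open>A = R \<inter> S\<close>, \<open>\<aa> = (A - 1)\<int>[G]\<close> and \<open>K = [R,S][A,T]\<close>.  That \<open>K\<close> lies in the left-hand side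
  is the computation \<open>[x,y] - 1 = ((x - 1)(y - 1) - (y - 1)(x - 1)) x\<inverse>y\<inverse>\<close>.

  For the converse, everything is reduced to additive generators.  The ideal of a normal subgroup \<open>N\<close>
  is spanned over \<open>\<int>\<close> by the elements \<open>g(n - 1)\<close> (\<open>relative_augmentation_ideal_eq_span\<close>), so a product
  of two such ideals is spanned by the second differences \<open>g(x - 1)(y - 1)\<close>.  The intersection
  \<open>\<rr> \<inter> \<ss>\<close> is no obstacle because \<open>\<rr> \<inter> \<ss> \<subseteq> \<rr>\<ss> + \<aa>\<close> (\<open>ideal_inter_subset_span\<close>): multiplied by \<open>\<tt>\<close> on
  either side, its first part stays inside \<open>\<rr>\<ss>\<close>.  Hence the whole sum is spanned by the second
  differences for the pairs \<open>(R,S)\<close>, \<open>(S,R)\<close>, \<open>(A,T)\<close> and \<open>(T,A)\<close> (\<open>ideal_sum_subset_span\<close>).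

  It remains to find an additive map on \<open>\<int>[G]\<close> that kills these second differences and still sees
  the elements of \<open>A\<close> modulo \<open>K\<close>.  Every \<open>x \<in> G\<close> is written as \<open>x = \<gamma>(x) \<rho>(x) \<sigma>(x) \<epsilon>(x)\<close>, where \<open>\<gamma>(x)\<close>
  represents \<open>xRS\<close>, \<open>\<rho>(x) \<in> R\<close> depends on \<open>xS\<close> only, \<open>\<sigma>(x) \<in> S\<close> depends on \<open>xR\<close> only, and
  \<open>\<epsilon>(x) \<in> A\<close> is the remaining factor (\<open>transversal\<close>).  Modulo \<open>K\<close> the groups \<open>R\<close> and \<open>S\<close> commute, and so
  do \<open>A\<close> and \<open>T\<close>; therefore the additive extension of \<open>x \<mapsto> K\<epsilon>(x)\<close> to a map \<open>\<int>[G] \<rightarrow> A/K\<close> has the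
  required kernel (\<open>trivial_image_of_span_second_diffs\<close>).  If \<open>g - 1\<close> lies in the ideal, then it lies
  in \<open>\<rr> \<inter> \<ss>\<close>, so \<open>g \<in> A\<close>; since \<open>\<epsilon>(xa) = \<epsilon>(x)a\<close> for \<open>a \<in> A\<close>, such a \<open>g\<close> satisfies \<open>K\<epsilon>(1)g = K\<epsilon>(1)\<close>, that is, \<open>g \<in> K\<close>.  The same
  decomposition of \<open>x\<close> gives the formula for \<open>\<rr> \<inter> \<ss>\<close>.
\<close>

section \<open>Additive subgroups of the group ring\<close>

text \<open>
  Viewing the free abelian group as a \<open>\<int>\<close>-module makes spans available: an additive subgroup
  is a \<open>frag.subspace\<close>, and the subgroup generated by a set is its \<open>frag.span\<close>.
\<close>
global_interpretation frag: Modules.module frag_cmul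
  by unfold_locales (simp_all add: frag_cmul_distrib frag_cmul_distrib2)

lemma frag_subspaceI:
  assumes "0 \<in> W" "\<And>u v. u \<in> W \<Longrightarrow> v \<in> W \<Longrightarrow> u - v \<in> W"
  shows "frag.subspace W"
proof (rule frag.subspaceI)
  have m: "- u \<in> W" if "u \<in> W" for u
    using assms(2)[OF assms(1) that] by simp
  show "u + v \<in> W" if "u \<in> W" "v \<in> W" for u v
    using assms(2)[OF that(1) m[OF that(2)]] by simp
  show "frag_cmul c u \<in> W" if "u \<in> W" for c u
    by (rule frag_closure_minus_cmul[of "\<lambda>u. u \<in> W"]) (use assms that in auto)
qed (use assms in auto)

lemma span_frag_of: "frag.span (frag_of ` C) = {u. Poly_Mapping.keys u \<subseteq> C}"
proof (intro equalityI subsetI)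
  have "frag.subspace {u :: 'a \<Rightarrow>\<^sub>0 int. Poly_Mapping.keys u \<subseteq> C}"
    by (rule frag_subspaceI) (use keys_diff in fastforce)+
  then have "frag.span (frag_of ` C) \<subseteq> {u. Poly_Mapping.keys u \<subseteq> C}"
    by (intro frag.span_minimal) auto
  then show "u \<in> {u. Poly_Mapping.keys u \<subseteq> C}" if "u \<in> frag.span (frag_of ` C)" for u
    using that by blast
  fix u :: "'a \<Rightarrow>\<^sub>0 int" assume "u \<in> {u. Poly_Mapping.keys u \<subseteq> C}"
  then have "Poly_Mapping.keys u \<subseteq> C" by simp
  then show "u \<in> frag.span (frag_of ` C)"
    by (induction u rule: frag_induction) (auto intro: frag.span_zero frag.span_base frag.span_diff)
qed

lemma frag_extend_in_subspace:
  assumes W: "frag.subspace W" and f: "\<And>x. x \<in> C \<Longrightarrow> f x \<in> W" and u: "Poly_Mapping.keys u \<subseteq> C"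
  shows "frag_extend f u \<in> W"
  using u by (induction u rule: frag_induction)
    (simp_all add: f frag_extend_diff frag.subspace_0[OF W] frag.subspace_diff[OF W])

text \<open>By bilinearity of the product it suffices to multiply generators.\<close>
lemma group_ring_mult_span:
  fixes G :: "('a, 'b) monoid_scheme"
  assumes W: "frag.subspace W"
    and PQ: "\<And>x y. x \<in> P \<Longrightarrow> y \<in> Q \<Longrightarrow> x \<otimes>\<^bsub>group_ring G\<^esub> y \<in> W"
    and u: "u \<in> frag.span P" and v: "v \<in> frag.span Q"
  shows "u \<otimes>\<^bsub>group_ring G\<^esub> v \<in> W"
proof -
  have "frag.subspace {v. x \<otimes>\<^bsub>group_ring G\<^esub> v \<in> W}" for x
    by (rule frag_subspaceI) (simp_all add: frag_extend_diff frag_extend_fun_diff frag_extend_fun_0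
      frag.subspace_0[OF W] frag.subspace_diff[OF W])
  then have "frag.span Q \<subseteq> {v. x \<otimes>\<^bsub>group_ring G\<^esub> v \<in> W}" if "x \<in> P" for x
    by (intro frag.span_minimal) (use PQ that in blast)+
  then have *: "x \<otimes>\<^bsub>group_ring G\<^esub> v \<in> W" if "x \<in> P" for x using v that by blast
  have "frag.subspace {u. u \<otimes>\<^bsub>group_ring G\<^esub> v \<in> W}"
    by (rule frag_subspaceI) (simp_all add: frag_extend_diff
      frag.subspace_0[OF W] frag.subspace_diff[OF W])
  then have "frag.span P \<subseteq> {u. u \<otimes>\<^bsub>group_ring G\<^esub> v \<in> W}"
    by (intro frag.span_minimal) (use * in blast)+
  then show ?thesis using u by blast
qed

lemma ideal_prod_subset_subspace:
  fixes G :: "('a, 'b) monoid_scheme"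
  assumes W: "frag.subspace W" and "I \<subseteq> frag.span P" "J \<subseteq> frag.span Q"
    and PQ: "\<And>x y. x \<in> P \<Longrightarrow> y \<in> Q \<Longrightarrow> x \<otimes>\<^bsub>group_ring G\<^esub> y \<in> W"
  shows "I \<cdot>\<^bsub>group_ring G\<^esub> J \<subseteq> W"
proof
  fix u assume "u \<in> I \<cdot>\<^bsub>group_ring G\<^esub> J"
  then show "u \<in> W"
  proof (induction u rule: ideal_prod.induct)
    case (prod i j)
    then show ?case using group_ring_mult_span[OF W PQ] assms(2,3) by blast
  next
    case (sum u v)
    then show ?case by (simp add: frag.subspace_add[OF W])
  qed
qed

lemma set_add_subset_subspace:
  assumes "frag.subspace W" "I \<subseteq> W" "J \<subseteq> W"
  shows "I <+>\<^bsub>group_ring G\<^esub> J \<subseteq> W"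
  using assms by (auto simp: set_add_def' intro!: frag.subspace_add)

section \<open>Relative augmentation ideals\<close>

text \<open>The elements \<open>g(n - 1)\<close> of the group ring, in expanded form.\<close>
definition coset_diffs :: "('a, 'b) monoid_scheme \<Rightarrow> 'a set \<Rightarrow> ('a \<Rightarrow>\<^sub>0 int) set" where
  "coset_diffs G N = {frag_of (g \<otimes>\<^bsub>G\<^esub> n) - frag_of g | g n. g \<in> carrier G \<and> n \<in> N}"

text \<open>The elements \<open>g(a - 1)(b - 1)\<close> of the group ring, in expanded form.\<close>
definition second_diffs ::
    "('a, 'b) monoid_scheme \<Rightarrow> 'a set \<Rightarrow> 'a set \<Rightarrow> ('a \<Rightarrow>\<^sub>0 int) set" where
  "second_diffs G A B =
    {frag_of (g \<otimes>\<^bsub>G\<^esub> a \<otimes>\<^bsub>G\<^esub> b) - frag_of (g \<otimes>\<^bsub>G\<^esub> a) - frag_of (g \<otimes>\<^bsub>G\<^esub> b) + frag_of g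
     | g a b. g \<in> carrier G \<and> a \<in> A \<and> b \<in> B}"

lemma coset_diffsI:
  "g \<in> carrier G \<Longrightarrow> n \<in> N \<Longrightarrow> frag_of (g \<otimes>\<^bsub>G\<^esub> n) - frag_of g \<in> coset_diffs G N"
  by (auto simp: coset_diffs_def)

lemma second_diffsI:
  "g \<in> carrier G \<Longrightarrow> a \<in> A \<Longrightarrow> b \<in> B \<Longrightarrow>
   frag_of (g \<otimes>\<^bsub>G\<^esub> a \<otimes>\<^bsub>G\<^esub> b) - frag_of (g \<otimes>\<^bsub>G\<^esub> a) - frag_of (g \<otimes>\<^bsub>G\<^esub> b) + frag_of g
   \<in> second_diffs G A B"
  by (auto simp: second_diffs_def)

lemma ideal_group_ring_subspace:
  assumes "group G" "ideal I (group_ring G)"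
  shows "frag.subspace I"
proof (rule frag_subspaceI)
  interpret group G by fact
  interpret Z: ring "group_ring G" by (rule ring_group_ring) fact
  interpret ideal I "group_ring G" by fact
  show "0 \<in> I" using zero_closed by simp
  have m: "- v \<in> I" if "v \<in> I" for v
  proof -
    have "- v = (- frag_of \<one>\<^bsub>G\<^esub>) \<otimes>\<^bsub>group_ring G\<^esub> v"
    proof -
      have "Poly_Mapping.keys v \<subseteq> carrier G" using Icarr[OF that] by simp
      then have "frag_extend (\<lambda>y. frag_of (\<one>\<^bsub>G\<^esub> \<otimes>\<^bsub>G\<^esub> y)) v = frag_extend frag_of v"
        by (intro frag_extend_eq) auto
      then show ?thesis by (simp add: frag_extend_minus flip: frag_expansion)
    qed
    also have "\<dots> \<in> I" using that by (intro I_l_closed) auto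
    finally show ?thesis .
  qed
  show "u - v \<in> I" if "u \<in> I" "v \<in> I" for u v
    using a_closed[OF that(1) m[OF that(2)]] by simp
qed

context group
begin

lemma inv_mult_cancel:
  assumes "x \<in> carrier G" "y \<in> carrier G"
  shows "inv x \<otimes> (x \<otimes> y) = y" "x \<otimes> (inv x \<otimes> y) = y"
  using assms by (simp_all flip: m_assoc)

lemma normal_mult_swap:
  assumes "N \<lhd> G" "n \<in> N" "g \<in> carrier G"
  obtains m where "m \<in> N" "n \<otimes> g = g \<otimes> m"
proof
  interpret normal N G by fact
  show "inv g \<otimes> n \<otimes> g \<in> N" using assms inv_op_closed1 by blast
  show "n \<otimes> g = g \<otimes> (inv g \<otimes> n \<otimes> g)"
    using assms mem_carrier by (simp add: m_assoc inv_mult_cancel)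
qed

lemma relative_augmentation_ideal_ideal:
  assumes "N \<subseteq> carrier G"
  shows "ideal (relative_augmentation_ideal G N) (group_ring G)"
  unfolding relative_augmentation_ideal_def
proof (rule ring.genideal_ideal)
  show "{frag_of x - frag_of \<one> |x. x \<in> N} \<subseteq> carrier (group_ring G)"
    using assms keys_diff[of "frag_of _ :: 'a \<Rightarrow>\<^sub>0 int" "frag_of \<one>"] by fastforce
qed (rule ring_group_ring[OF group_axioms])

lemma diff_one_in_relative_augmentation_ideal:
  assumes "N \<subseteq> carrier G" "x \<in> N"
  shows "frag_of x - frag_of \<one> \<in> relative_augmentation_ideal G N"
proof -
  have "{frag_of x - frag_of \<one> |x. x \<in> N} \<subseteq> carrier (group_ring G)"
    using assms keys_diff[of "frag_of _ :: 'a \<Rightarrow>\<^sub>0 int" "frag_of \<one>"] by fastforce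
  from ring.genideal_self[OF ring_group_ring[OF group_axioms] this] show ?thesis
    using assms(2) unfolding relative_augmentation_ideal_def by blast
qed

text \<open>
  The span is already an ideal: on the left, \<open>h \<cdot> g(n - 1) = (hg)(n - 1)\<close>, and on the right
  \<open>g(n - 1) \<cdot> h = (gh)(m - 1)\<close> with \<open>m = h\<inverse>nh \<in> N\<close>.
\<close>
lemma relative_augmentation_ideal_eq_span:
  assumes N: "N \<lhd> G"
  shows "relative_augmentation_ideal G N = frag.span (coset_diffs G N)"
proof
  interpret N: normal N G by fact
  interpret Z: ring "group_ring G" by (rule ring_group_ring[OF group_axioms])
  have ideal: "ideal (frag.span (coset_diffs G N)) (group_ring G)"
  proof (rule idealI)
    have D: "coset_diffs G N \<subseteq> {u. Poly_Mapping.keys u \<subseteq> carrier G}"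
      using keys_diff[of "frag_of _ :: 'a \<Rightarrow>\<^sub>0 int" "frag_of _"] unfolding coset_diffs_def by fastforce
    have S: "frag.span (coset_diffs G N) \<subseteq> {u. Poly_Mapping.keys u \<subseteq> carrier G}"
      using frag.span_minimal[OF D] by (metis frag.subspace_span span_frag_of)
    show "subgroup (frag.span (coset_diffs G N)) (add_monoid (group_ring G))"
    proof (rule group.subgroupI)
      show "group (add_monoid (group_ring G))" by (rule Z.a_group)
      show "inv\<^bsub>add_monoid (group_ring G)\<^esub> u \<in> frag.span (coset_diffs G N)"
        if u: "u \<in> frag.span (coset_diffs G N)" for u
      proof -
        have "\<ominus>\<^bsub>group_ring G\<^esub> u = - u"
          using S u by (intro Z.minus_equality) auto
        then show ?thesis using u by (simp add: a_inv_def frag.span_neg)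
      qed
    qed (use S frag.span_zero in \<open>auto intro: frag.span_add\<close>)
    fix u x assume u: "u \<in> frag.span (coset_diffs G N)" and x: "x \<in> carrier (group_ring G)"
    have x': "x \<in> frag.span (frag_of ` carrier G)" using x by (simp add: span_frag_of)
    show "x \<otimes>\<^bsub>group_ring G\<^esub> u \<in> frag.span (coset_diffs G N)"
    proof (rule group_ring_mult_span[OF frag.subspace_span _ x' u])
      fix y d assume "y \<in> frag_of ` carrier G" "d \<in> coset_diffs G N"
      then obtain h g n where h: "h \<in> carrier G" "y = frag_of h" and g: "g \<in> carrier G" "n \<in> N"
        "d = frag_of (g \<otimes> n) - frag_of g" by (auto simp: coset_diffs_def)
      have "y \<otimes>\<^bsub>group_ring G\<^esub> d = frag_of (h \<otimes> g \<otimes> n) - frag_of (h \<otimes> g)"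
        using h g by (simp add: frag_extend_diff m_assoc)
      then show "y \<otimes>\<^bsub>group_ring G\<^esub> d \<in> frag.span (coset_diffs G N)"
        using h g by (simp only:) (intro frag.span_base coset_diffsI m_closed)
    qed
    show "u \<otimes>\<^bsub>group_ring G\<^esub> x \<in> frag.span (coset_diffs G N)"
    proof (rule group_ring_mult_span[OF frag.subspace_span _ u x'])
      fix y d assume "y \<in> frag_of ` carrier G" "d \<in> coset_diffs G N"
      then obtain h g n where h: "h \<in> carrier G" "y = frag_of h" and g: "g \<in> carrier G" "n \<in> N"
        "d = frag_of (g \<otimes> n) - frag_of g" by (auto simp: coset_diffs_def)
      obtain m where m: "m \<in> N" "n \<otimes> h = h \<otimes> m" using normal_mult_swap N g h by metis
      have "d \<otimes>\<^bsub>group_ring G\<^esub> y = frag_of (g \<otimes> h \<otimes> m) - frag_of (g \<otimes> h)"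
        using h g m by (simp add: frag_extend_diff m_assoc)
      then show "d \<otimes>\<^bsub>group_ring G\<^esub> y \<in> frag.span (coset_diffs G N)"
        using h g m by (simp only:) (intro frag.span_base coset_diffsI m_closed)
    qed
  qed (rule ring_group_ring[OF group_axioms])
  show "relative_augmentation_ideal G N \<subseteq> frag.span (coset_diffs G N)"
    unfolding relative_augmentation_ideal_def
  proof (rule Z.genideal_minimal[OF ideal])
    show "{frag_of x - frag_of \<one> |x. x \<in> N} \<subseteq> frag.span (coset_diffs G N)"
      using coset_diffsI[of \<one> G _ N] by (auto intro!: frag.span_base)
  qed
  show "frag.span (coset_diffs G N) \<subseteq> relative_augmentation_ideal G N"
  proof (rule frag.span_minimal)
    interpret I: ideal "relative_augmentation_ideal G N" "group_ring G"
      by (rule relative_augmentation_ideal_ideal) (use N.subset in blast)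
    show "frag.subspace (relative_augmentation_ideal G N)"
      by (rule ideal_group_ring_subspace[OF group_axioms I.is_ideal])
    show "coset_diffs G N \<subseteq> relative_augmentation_ideal G N"
    proof
      fix d assume "d \<in> coset_diffs G N"
      then obtain g n where g: "g \<in> carrier G" "n \<in> N" "d = frag_of (g \<otimes> n) - frag_of g"
        by (auto simp: coset_diffs_def)
      then have "d = frag_of g \<otimes>\<^bsub>group_ring G\<^esub> (frag_of n - frag_of \<one>)"
        by (simp add: frag_extend_diff)
      also have "\<dots> \<in> relative_augmentation_ideal G N"
        using g N.subset by (intro I.I_l_closed diff_one_in_relative_augmentation_ideal) auto
      finally show "d \<in> relative_augmentation_ideal G N" .
    qed
  qed
qed

text \<open>
  The ideal of \<open>N\<close> is the kernel of \<open>\<int>[G] \<rightarrow> \<int>[G/N]\<close>, so any additive map that factors through the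
  cosets of \<open>N\<close> vanishes on it.
\<close>
lemma frag_extend_relative_augmentation_ideal:
  assumes N: "N \<lhd> G" and f: "\<And>x n. x \<in> carrier G \<Longrightarrow> n \<in> N \<Longrightarrow> f (x \<otimes> n) = f x"
    and u: "u \<in> relative_augmentation_ideal G N"
  shows "frag_extend f u = 0"
proof -
  have "frag.span (coset_diffs G N) \<subseteq> {u. frag_extend f u = 0}"
  proof (rule frag.span_minimal)
    show "frag.subspace {u. frag_extend f u = 0}"
      by (rule frag_subspaceI) (simp_all add: frag_extend_diff)
  qed (auto simp: coset_diffs_def frag_extend_diff f)
  then show ?thesis using u unfolding relative_augmentation_ideal_eq_span[OF N] by blast
qed

text \<open>Apply the previous lemma to the function that sends an element to its own coset.\<close>
lemma ideal_subgroup_relative_augmentation_ideal: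
  assumes N: "N \<lhd> G" and g: "g \<in> carrier G" "frag_of g - frag_of \<one> \<in> relative_augmentation_ideal G N"
  shows "g \<in> N"
proof -
  interpret N: normal N G by fact
  have "frag_extend (\<lambda>x. frag_of (x <# N)) (frag_of g - frag_of \<one>) = 0"
  proof (rule frag_extend_relative_augmentation_ideal[OF N _ g(2)])
    fix x n assume xn: "x \<in> carrier G" "n \<in> N"
    have "x \<otimes> n \<in> x <# N" using xn by (auto simp: l_coset_def)
    from l_repr_independence[OF this xn(1) N.is_subgroup]
    show "frag_of (x \<otimes> n <# N) = frag_of (x <# N)" by simp
  qed
  then have "g <# N = \<one> <# N" by (simp add: frag_extend_diff frag_of_eq)
  then have "g <# N = N" using N.subset by (simp add: lcos_mult_one)
  moreover have "g \<otimes> \<one> \<in> g <# N" by (auto simp: l_coset_def)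
  ultimately show ?thesis using g by simp
qed


section \<open>A decomposition adapted to two normal subgroups\<close>

text \<open>
  With \<open>\<gamma> x\<close> a representative of \<open>x R S\<close>, the coset \<open>x S\<close> meets \<open>\<gamma> x R\<close> and the coset \<open>x R\<close> meets
  \<open>\<gamma> x S\<close>.  Choosing a point in each intersection from the coset alone, and not from \<open>x\<close>, gives
  \<open>\<rho> x\<close> and \<open>\<sigma> x\<close>.  The product \<open>\<gamma> x \<rho> x \<sigma> x\<close> is then congruent to \<open>x\<close> modulo \<open>R\<close> and modulo \<open>S\<close>,
  so that the correction \<open>\<epsilon> x\<close> lies in \<open>R \<inter> S\<close>.
\<close>
lemma transversal:
  assumes R: "R \<lhd> G" and S: "S \<lhd> G"
  obtains \<gamma> \<rho> \<sigma> \<epsilon> where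
    "\<And>x. x \<in> carrier G \<Longrightarrow> \<gamma> x \<in> carrier G"
    "\<And>x. x \<in> carrier G \<Longrightarrow> \<rho> x \<in> R"
    "\<And>x. x \<in> carrier G \<Longrightarrow> \<sigma> x \<in> S"
    "\<And>x. x \<in> carrier G \<Longrightarrow> \<epsilon> x \<in> R \<inter> S"
    "\<And>x. x \<in> carrier G \<Longrightarrow> x = \<gamma> x \<otimes> \<rho> x \<otimes> \<sigma> x \<otimes> \<epsilon> x"
    "\<And>x r. x \<in> carrier G \<Longrightarrow> r \<in> R \<Longrightarrow> \<gamma> (x \<otimes> r) = \<gamma> x \<and> \<sigma> (x \<otimes> r) = \<sigma> x"
    "\<And>x s. x \<in> carrier G \<Longrightarrow> s \<in> S \<Longrightarrow> \<gamma> (x \<otimes> s) = \<gamma> x \<and> \<rho> (x \<otimes> s) = \<rho> x"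
proof -
  interpret R: normal R G by fact
  interpret S: normal S G by fact
  have coset_eq: "x \<otimes> n <# N = x <# N" if "subgroup N G" "x \<in> carrier G" "n \<in> N" for N x n
    using l_repr_independence[of "x \<otimes> n" x N] that by (auto simp: l_coset_def)
  have RS: "subgroup (R <#> S) G"
    using mult_norm_subgroup[OF R S.is_subgroup] .
  have R_RS: "r \<in> R <#> S" if "r \<in> R" for r
  proof -
    have "r \<otimes> \<one> \<in> R <#> S" unfolding set_mult_def using that S.one_closed by blast
    then show ?thesis using R.mem_carrier[OF that] by simp
  qed
  have S_RS: "s \<in> R <#> S" if "s \<in> S" for s
  proof -
    have "\<one> \<otimes> s \<in> R <#> S" unfolding set_mult_def using that R.one_closed by blast
    then show ?thesis using S.mem_carrier[OF that] by simp
  qed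
  define \<gamma> where "\<gamma> x = (SOME y. y \<in> x <# (R <#> S))" for x
  define \<rho> where "\<rho> x = (SOME r. r \<in> R \<and> \<gamma> x \<otimes> r \<in> x <# S)" for x
  define \<sigma> where "\<sigma> x = (SOME s. s \<in> S \<and> \<gamma> x \<otimes> s \<in> x <# R)" for x
  define \<epsilon> where "\<epsilon> x = inv (\<gamma> x \<otimes> \<rho> x \<otimes> \<sigma> x) \<otimes> x" for x
  have \<gamma>_RS: "\<exists>r\<in>R. \<exists>s\<in>S. \<gamma> x = x \<otimes> (r \<otimes> s)" if "x \<in> carrier G" for x
  proof -
    have "x \<otimes> \<one> \<in> x <# (R <#> S)" using R_RS[OF R.one_closed] by (auto simp: l_coset_def)
    then have "\<gamma> x \<in> x <# (R <#> S)" unfolding \<gamma>_def by (rule someI)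
    then show ?thesis by (auto simp: l_coset_def set_mult_def)
  qed
  have \<gamma>: "\<gamma> x \<in> carrier G" if "x \<in> carrier G" for x
    using \<gamma>_RS[OF that] that R.mem_carrier S.mem_carrier by auto
  have \<rho>: "\<rho> x \<in> R \<and> \<gamma> x \<otimes> \<rho> x \<in> x <# S" if x: "x \<in> carrier G" for x
  proof -
    obtain r s where rs: "r \<in> R" "s \<in> S" "\<gamma> x = x \<otimes> (r \<otimes> s)" using \<gamma>_RS[OF x] by blast
    note c = R.mem_carrier[OF rs(1)] S.mem_carrier[OF rs(2)]
    have "inv s \<otimes> inv r \<otimes> s \<in> R" using R.inv_op_closed1[OF c(2) R.m_inv_closed[OF rs(1)]] .
    moreover have "\<gamma> x \<otimes> (inv s \<otimes> inv r \<otimes> s) = x \<otimes> s"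
      using rs c x by (simp add: m_assoc inv_mult_cancel)
    then have "\<gamma> x \<otimes> (inv s \<otimes> inv r \<otimes> s) \<in> x <# S" using rs by (auto simp: l_coset_def)
    ultimately show ?thesis unfolding \<rho>_def
      by (rule someI[where P="\<lambda>r. r \<in> R \<and> \<gamma> x \<otimes> r \<in> x <# S", OF conjI])
  qed
  have \<sigma>: "\<sigma> x \<in> S \<and> \<gamma> x \<otimes> \<sigma> x \<in> x <# R" if x: "x \<in> carrier G" for x
  proof -
    obtain r s where rs: "r \<in> R" "s \<in> S" "\<gamma> x = x \<otimes> (r \<otimes> s)" using \<gamma>_RS[OF x] by blast
    note c = R.mem_carrier[OF rs(1)] S.mem_carrier[OF rs(2)]
    have "\<gamma> x \<otimes> inv s = x \<otimes> r" using rs c x by (simp add: m_assoc)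
    then have "\<gamma> x \<otimes> inv s \<in> x <# R" using rs by (auto simp: l_coset_def)
    with S.m_inv_closed[OF rs(2)] show ?thesis unfolding \<sigma>_def
      by (rule someI[where P="\<lambda>s. s \<in> S \<and> \<gamma> x \<otimes> s \<in> x <# R", OF conjI])
  qed
  show thesis
  proof
    fix x assume x: "x \<in> carrier G"
    show "\<gamma> x \<in> carrier G" "\<rho> x \<in> R" "\<sigma> x \<in> S" using \<gamma> \<rho> \<sigma> x by auto
    note rs = this(2,3)
    note c = x \<gamma>[OF x] R.mem_carrier[OF rs(1)] S.mem_carrier[OF rs(2)]
    show "x = \<gamma> x \<otimes> \<rho> x \<otimes> \<sigma> x \<otimes> \<epsilon> x"
      using c unfolding \<epsilon>_def by (simp add: m_assoc inv_mult_group inv_mult_cancel)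
    obtain s where s: "s \<in> S" "\<gamma> x \<otimes> \<rho> x = x \<otimes> s" using \<rho>[OF x] by (auto simp: l_coset_def)
    obtain r where r: "r \<in> R" "\<gamma> x \<otimes> \<sigma> x = x \<otimes> r" using \<sigma>[OF x] by (auto simp: l_coset_def)
    note c' = c R.mem_carrier[OF r(1)] S.mem_carrier[OF s(1)]
    have "\<epsilon> x = inv (x \<otimes> s \<otimes> \<sigma> x) \<otimes> x" by (simp add: \<epsilon>_def s(2))
    also have "\<dots> = inv (\<sigma> x) \<otimes> inv s"
      using c' by (simp add: m_assoc inv_mult_group)
    also have "\<dots> \<in> S" using rs s by blast
    finally have "\<epsilon> x \<in> S" .
    moreover have "\<epsilon> x = (inv (\<sigma> x) \<otimes> inv (\<rho> x) \<otimes> \<sigma> x) \<otimes> (inv (\<gamma> x \<otimes> \<sigma> x) \<otimes> x)"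
      using c by (simp add: \<epsilon>_def m_assoc inv_mult_group inv_mult_cancel)
    then have "\<epsilon> x = (inv (\<sigma> x) \<otimes> inv (\<rho> x) \<otimes> \<sigma> x) \<otimes> inv r"
      using c' by (simp add: r(2) inv_mult_group m_assoc)
    then have "\<epsilon> x \<in> R"
      using R.inv_op_closed1[OF c(4) R.m_inv_closed[OF rs(1)]] r(1) by simp
    ultimately show "\<epsilon> x \<in> R \<inter> S" by blast
  next
    fix x r assume x: "x \<in> carrier G" and r: "r \<in> R"
    have "\<gamma> (x \<otimes> r) = \<gamma> x"
      unfolding \<gamma>_def using coset_eq[OF RS x R_RS[OF r]] by simp
    then show "\<gamma> (x \<otimes> r) = \<gamma> x \<and> \<sigma> (x \<otimes> r) = \<sigma> x"
      unfolding \<sigma>_def using coset_eq[OF R.is_subgroup x r] by simp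
  next
    fix x s assume x: "x \<in> carrier G" and s: "s \<in> S"
    have "\<gamma> (x \<otimes> s) = \<gamma> x"
      unfolding \<gamma>_def using coset_eq[OF RS x S_RS[OF s]] by simp
    then show "\<gamma> (x \<otimes> s) = \<gamma> x \<and> \<rho> (x \<otimes> s) = \<rho> x"
      unfolding \<rho>_def using coset_eq[OF S.is_subgroup x s] by simp
  qed
qed

text \<open>
  In the decomposition above put \<open>\<alpha> = \<gamma>\<rho>\<close>, \<open>\<beta> = \<gamma>\<sigma>\<close>.  Then \<open>x - \<alpha> x - \<beta> x + \<gamma> x\<close> is a second
  difference plus \<open>x - \<gamma>\<rho>\<sigma> x\<close>, hence in \<open>\<rr>\<ss> + \<aa>\<close> with \<open>\<aa>\<close> the ideal of \<open>R \<inter> S\<close>.  Summed over the terms of an element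
  \<open>u \<in> \<rr> \<inter> \<ss>\<close>, the parts coming from \<open>\<alpha>\<close>, \<open>\<beta>\<close>, \<open>\<gamma>\<close> cancel, because these functions are constant on
  cosets of \<open>S\<close> or of \<open>R\<close>; what is left is \<open>u\<close> itself.
\<close>
lemma ideal_inter_subset_span:
  assumes R: "R \<lhd> G" and S: "S \<lhd> G"
  shows "relative_augmentation_ideal G R \<inter> relative_augmentation_ideal G S
    \<subseteq> frag.span (second_diffs G R S \<union> coset_diffs G (R \<inter> S))"
proof
  interpret R: normal R G by fact
  interpret S: normal S G by fact
  fix u assume u: "u \<in> relative_augmentation_ideal G R \<inter> relative_augmentation_ideal G S"
  obtain \<gamma> \<rho> \<sigma> \<epsilon> where \<gamma>: "\<And>x. x \<in> carrier G \<Longrightarrow> \<gamma> x \<in> carrier G"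
    and \<rho>: "\<And>x. x \<in> carrier G \<Longrightarrow> \<rho> x \<in> R"
    and \<sigma>: "\<And>x. x \<in> carrier G \<Longrightarrow> \<sigma> x \<in> S"
    and \<epsilon>: "\<And>x. x \<in> carrier G \<Longrightarrow> \<epsilon> x \<in> R \<inter> S"
    and decomp: "\<And>x. x \<in> carrier G \<Longrightarrow> x = \<gamma> x \<otimes> \<rho> x \<otimes> \<sigma> x \<otimes> \<epsilon> x"
    and r: "\<And>x r. x \<in> carrier G \<Longrightarrow> r \<in> R \<Longrightarrow> \<gamma> (x \<otimes> r) = \<gamma> x \<and> \<sigma> (x \<otimes> r) = \<sigma> x"
    and s: "\<And>x s. x \<in> carrier G \<Longrightarrow> s \<in> S \<Longrightarrow> \<gamma> (x \<otimes> s) = \<gamma> x \<and> \<rho> (x \<otimes> s) = \<rho> x"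
    by (rule transversal[OF R S]) blast
  let ?V = "frag.span (second_diffs G R S \<union> coset_diffs G (R \<inter> S))"
  let ?f = "\<lambda>x. frag_of x - frag_of (\<gamma> x \<otimes> \<rho> x) - frag_of (\<gamma> x \<otimes> \<sigma> x) + frag_of (\<gamma> x)"
  have f: "?f x \<in> ?V" if x: "x \<in> carrier G" for x
  proof -
    let ?y = "\<gamma> x \<otimes> \<rho> x \<otimes> \<sigma> x"
    have y: "?y \<in> carrier G" using \<gamma> \<rho> \<sigma> x by simp
    have "frag_of ?y - frag_of (\<gamma> x \<otimes> \<rho> x) - frag_of (\<gamma> x \<otimes> \<sigma> x) + frag_of (\<gamma> x) \<in> ?V"
      using \<gamma> \<rho> \<sigma> x by (intro frag.span_base UnI1 second_diffsI) auto
    moreover have "frag_of (?y \<otimes> \<epsilon> x) - frag_of ?y \<in> ?V"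
      using y \<epsilon> x by (intro frag.span_base UnI2 coset_diffsI) auto
    ultimately have "(frag_of ?y - frag_of (\<gamma> x \<otimes> \<rho> x) - frag_of (\<gamma> x \<otimes> \<sigma> x) + frag_of (\<gamma> x))
        + (frag_of (?y \<otimes> \<epsilon> x) - frag_of ?y) \<in> ?V" by (rule frag.span_add)
    then show ?thesis by (simp add: algebra_simps flip: decomp[OF x])
  qed
  have keys: "Poly_Mapping.keys u \<subseteq> carrier G"
    using ideal.Icarr[OF relative_augmentation_ideal_ideal[OF R.subset], of u] u by auto
  have "frag_extend (\<lambda>x. frag_of (\<gamma> x \<otimes> \<rho> x)) u = 0"
    by (rule frag_extend_relative_augmentation_ideal[OF S]) (use s u in auto)
  moreover have "frag_extend (\<lambda>x. frag_of (\<gamma> x \<otimes> \<sigma> x)) u = 0"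
    by (rule frag_extend_relative_augmentation_ideal[OF R]) (use r u in auto)
  moreover have "frag_extend (\<lambda>x. frag_of (\<gamma> x)) u = 0"
    by (rule frag_extend_relative_augmentation_ideal[OF R]) (use r u in auto)
  ultimately have "frag_extend ?f u = u"
    by (simp add: frag_extend_fun_add frag_extend_fun_diff flip: frag_expansion)
  moreover have "frag_extend ?f u \<in> ?V"
    by (rule frag_extend_in_subspace[OF frag.subspace_span f keys])
  ultimately show "u \<in> ?V" by (simp only:)
qed

end

section \<open>An additive map killing the second differences\<close>

text \<open>
  \<open>W\<close> is the kernel of the additive extension of \<open>\<phi>\<close>.  Only the values on first and second differences
  matter later, and these are expressed in the target group.
\<close>
lemma additive_extension_kernel:
  fixes M :: "('m, 'n) monoid_scheme" and \<phi> :: "'a \<Rightarrow> 'm"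
  assumes "comm_group M" "\<phi> ` C \<subseteq> carrier M"
  obtains W where "frag.subspace W"
    "\<And>x y. x \<in> C \<Longrightarrow> y \<in> C \<Longrightarrow> frag_of x - frag_of y \<in> W \<longleftrightarrow> \<phi> x = \<phi> y"
    "\<And>x y z w. x \<in> C \<Longrightarrow> y \<in> C \<Longrightarrow> z \<in> C \<Longrightarrow> w \<in> C \<Longrightarrow>
      frag_of x - frag_of y - frag_of z + frag_of w \<in> W \<longleftrightarrow> \<phi> x \<otimes>\<^bsub>M\<^esub> \<phi> w = \<phi> y \<otimes>\<^bsub>M\<^esub> \<phi> z"
proof -
  interpret M: comm_group M by fact
  obtain h where h: "h \<in> hom (free_Abelian_group C) M" "\<And>x. x \<in> C \<Longrightarrow> h (frag_of x) = \<phi> x"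
    using M.free_Abelian_group_universal[OF assms(2)] by blast
  interpret h: group_hom "free_Abelian_group C" M h
    by (simp add: group_hom_def group_hom_axioms_def h(1) M.is_group)
  let ?K = "{u :: 'a \<Rightarrow>\<^sub>0 int. Poly_Mapping.keys u \<subseteq> C}"
  have K: "frag.subspace ?K" by (metis frag.subspace_span span_frag_of)
  note Kc = frag.subspace_add[OF K, simplified] frag.subspace_diff[OF K, simplified]
  have add: "h (u + v) = h u \<otimes>\<^bsub>M\<^esub> h v" if "u \<in> ?K" "v \<in> ?K" for u v
    using h.hom_mult[of u v] that by simp
  have closed: "h u \<in> carrier M" if "u \<in> ?K" for u using h.hom_closed[of u] that by simp
  have diff: "h (u - v) = h u \<otimes>\<^bsub>M\<^esub> inv\<^bsub>M\<^esub> h v" if "u \<in> ?K" "v \<in> ?K" for u v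
  proof -
    have "h u = h (u - v) \<otimes>\<^bsub>M\<^esub> h v"
      using add[of "u - v" v] that Kc by simp
    then show ?thesis using that Kc closed by (simp add: M.m_assoc)
  qed
  have \<phi>: "\<phi> x \<in> carrier M" if "x \<in> C" for x using assms(2) that by blast
  let ?W = "{u \<in> ?K. h u = \<one>\<^bsub>M\<^esub>}"
  show thesis
  proof
    show "frag.subspace ?W"
      by (rule frag_subspaceI) (use h.hom_one diff Kc in auto)
    have d: "u - v \<in> ?W \<longleftrightarrow> h u = h v" if "u \<in> ?K" "v \<in> ?K" for u v
    proof -
      have "h u \<otimes>\<^bsub>M\<^esub> inv\<^bsub>M\<^esub> h v = \<one>\<^bsub>M\<^esub> \<longleftrightarrow> h u = h v"
        using M.inv_equality[of "h u" "inv\<^bsub>M\<^esub> h v"] closed[OF that(1)] closed[OF that(2)]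
        by (metis M.inv_closed M.inv_inv M.r_inv)
      then show ?thesis using diff[OF that] Kc that by simp
    qed
    show "frag_of x - frag_of y \<in> ?W \<longleftrightarrow> \<phi> x = \<phi> y" if "x \<in> C" "y \<in> C" for x y
      using d[of "frag_of x" "frag_of y"] that h(2) by simp
    show "frag_of x - frag_of y - frag_of z + frag_of w \<in> ?W \<longleftrightarrow>
        \<phi> x \<otimes>\<^bsub>M\<^esub> \<phi> w = \<phi> y \<otimes>\<^bsub>M\<^esub> \<phi> z"
      if "x \<in> C" "y \<in> C" "z \<in> C" "w \<in> C" for x y z w
    proof -
      have "frag_of x - frag_of y - frag_of z + frag_of w =
          (frag_of x + frag_of w) - (frag_of y + frag_of z)" by (simp add: algebra_simps)
      moreover have "h (frag_of x + frag_of w) = \<phi> x \<otimes>\<^bsub>M\<^esub> \<phi> w"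
        "h (frag_of y + frag_of z) = \<phi> y \<otimes>\<^bsub>M\<^esub> \<phi> z"
        using that h(2) by (simp_all add: add)
      ultimately show ?thesis
        using d[of "frag_of x + frag_of w" "frag_of y + frag_of z"] that Kc(1)
        by (simp only:) simp
    qed
  qed
qed

context group
begin

text \<open>
  Here \<open>x\<close>, \<open>xr\<close>, \<open>xs\<close>, \<open>xrs\<close> are given in coordinates of the kind produced by \<open>transversal\<close>.  Passing from \<open>x\<close>
  to \<open>xr\<close> changes only the coordinates in \<open>P\<close> and in \<open>P \<inter> Q\<close>, and passing to \<open>xs\<close> only those in \<open>Q\<close>
  and in \<open>P \<inter> Q\<close>; as \<open>P\<close> and \<open>Q\<close> commute, the two changes are independent.
\<close>
lemma commuting_coordinates:
  assumes carr: "P \<subseteq> carrier G" "Q \<subseteq> carrier G"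
    and comm: "\<And>x y. x \<in> P \<Longrightarrow> y \<in> Q \<Longrightarrow> x \<otimes> y = y \<otimes> x"
    and g: "g \<in> carrier G" and r: "r \<in> P" "r0 \<in> P" "r1 \<in> P" and s: "s \<in> Q" "s0 \<in> Q" "s1 \<in> Q"
    and a: "a0 \<in> P \<inter> Q" "a1 \<in> P \<inter> Q" "a2 \<in> P \<inter> Q" "a3 \<in> P \<inter> Q"
    and x: "g \<otimes> r0 \<otimes> s0 \<otimes> a0 = x"
    and xr: "g \<otimes> r1 \<otimes> s0 \<otimes> a1 = x \<otimes> r"
    and xs: "g \<otimes> r0 \<otimes> s1 \<otimes> a2 = x \<otimes> s"
    and xrs: "g \<otimes> r1 \<otimes> s1 \<otimes> a3 = x \<otimes> r \<otimes> s"
  shows "a3 \<otimes> a0 = a1 \<otimes> a2"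
proof -
  have c [simp]: "r \<in> carrier G" "r0 \<in> carrier G" "r1 \<in> carrier G" "s \<in> carrier G" "s0 \<in> carrier G"
    "s1 \<in> carrier G" "a0 \<in> carrier G" "a1 \<in> carrier G" "a2 \<in> carrier G" "a3 \<in> carrier G"
    using carr r s a by auto
  have swaps: "s0 \<otimes> r = r \<otimes> s0" "s0 \<otimes> r0 = r0 \<otimes> s0" "s0 \<otimes> r1 = r1 \<otimes> s0"
    "a0 \<otimes> r = r \<otimes> a0" "a0 \<otimes> s0 = s0 \<otimes> a0" "a0 \<otimes> s = s \<otimes> a0" "a1 \<otimes> s1 = s1 \<otimes> a1"
    using comm[OF r(1) s(2)] comm[OF r(2) s(2)] comm[OF r(3) s(2)] comm r s a by auto
  have assoc_swap: "x \<otimes> (y \<otimes> z) = y \<otimes> (x \<otimes> z)"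
    if "x \<otimes> y = y \<otimes> x" "x \<in> carrier G" "y \<in> carrier G" "z \<in> carrier G" for x y z
    using that by (simp flip: m_assoc)
  note ac = m_assoc swaps swaps[THEN assoc_swap]
  have "g \<otimes> (s0 \<otimes> (r1 \<otimes> a1)) = g \<otimes> (s0 \<otimes> (r0 \<otimes> (r \<otimes> a0)))"
    using xr g by (simp add: ac flip: x)
  then have 1: "r1 \<otimes> a1 = r0 \<otimes> (r \<otimes> a0)" using g by simp
  have "g \<otimes> (r0 \<otimes> (s1 \<otimes> a2)) = g \<otimes> (r0 \<otimes> (s0 \<otimes> (s \<otimes> a0)))"
    using xs g by (simp add: ac flip: x)
  then have 2: "s1 \<otimes> a2 = s0 \<otimes> (s \<otimes> a0)" using g by simp
  have "g \<otimes> (r1 \<otimes> (s1 \<otimes> a3)) = g \<otimes> (r0 \<otimes> (r \<otimes> (s0 \<otimes> (s \<otimes> a0))))"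
    using xrs g by (simp add: ac flip: x)
  then have 3: "r1 \<otimes> (s1 \<otimes> a3) = r0 \<otimes> (r \<otimes> (s0 \<otimes> (s \<otimes> a0)))" using g by simp
  have "(r1 \<otimes> s1) \<otimes> (a3 \<otimes> a0) = r1 \<otimes> (s1 \<otimes> a3) \<otimes> a0" by (simp add: m_assoc)
  also have "\<dots> = (r0 \<otimes> (r \<otimes> a0)) \<otimes> (s0 \<otimes> (s \<otimes> a0))" by (simp add: 3 ac)
  also have "\<dots> = (r1 \<otimes> a1) \<otimes> (s1 \<otimes> a2)" by (simp only: 1 2)
  also have "\<dots> = (r1 \<otimes> s1) \<otimes> (a1 \<otimes> a2)" by (simp add: ac)
  finally show ?thesis by simp
qed

text \<open>
  The function \<open>\<phi> = \<pi> \<circ> \<epsilon>\<close> takes values in the abelian group \<open>\<pi>(A)\<close>, \<open>A = R \<inter> S\<close>, and satisfies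
  \<open>\<phi>(xa) = \<phi>(x)\<pi>(a)\<close> for \<open>a \<in> A\<close>.  The vanishing of its additive extension on \<open>g(x - 1)(y - 1)\<close> means
  \<open>\<phi>(gxy)\<phi>(g) = \<phi>(gx)\<phi>(gy)\<close>.  For the pair \<open>(R,S)\<close> this is \<open>commuting_coordinates\<close>; for \<open>(A,T)\<close> it
  follows from \<open>gat = gt(t\<inverse>at)\<close> and \<open>\<pi>(t\<inverse>at) = \<pi>(a)\<close>.  Exchanging the two subgroups changes \<open>gxy\<close> by a
  commutator in \<open>A\<close> that \<open>\<pi>\<close> sends to \<open>1\<close>.
\<close>
lemma trivial_image_of_span_second_diffs:
  fixes H :: "('m, 'n) monoid_scheme" and \<pi> :: "'a \<Rightarrow> 'm"
  assumes H: "group H" and \<pi>: "\<pi> \<in> hom G H"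
    and R: "R \<lhd> G" and S: "S \<lhd> G" and T: "T \<subseteq> carrier G"
    and comm_RS: "\<And>r s. r \<in> R \<Longrightarrow> s \<in> S \<Longrightarrow> \<pi> r \<otimes>\<^bsub>H\<^esub> \<pi> s = \<pi> s \<otimes>\<^bsub>H\<^esub> \<pi> r"
    and comm_T: "\<And>a t. a \<in> R \<inter> S \<Longrightarrow> t \<in> T \<Longrightarrow> \<pi> a \<otimes>\<^bsub>H\<^esub> \<pi> t = \<pi> t \<otimes>\<^bsub>H\<^esub> \<pi> a"
    and g: "g \<in> R \<inter> S"
    and diff: "frag_of g - frag_of \<one> \<in> frag.span (second_diffs G R S \<union> second_diffs G S R
      \<union> second_diffs G (R \<inter> S) T \<union> second_diffs G T (R \<inter> S))"
  shows "\<pi> g = \<one>\<^bsub>H\<^esub>"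
proof -
  interpret H: group H by fact
  interpret \<pi>: group_hom G H \<pi> by unfold_locales (rule \<pi>)
  interpret R: normal R G by fact
  interpret S: normal S G by fact
  let ?A = "R \<inter> S"
  have A: "subgroup ?A G" using subgroups_Inter_pair R.is_subgroup S.is_subgroup by blast
  have Ac: "a \<in> carrier G" if "a \<in> ?A" for a using that R.mem_carrier by blast
  obtain \<gamma> \<rho> \<sigma> \<epsilon> where \<gamma>: "\<And>x. x \<in> carrier G \<Longrightarrow> \<gamma> x \<in> carrier G"
    and \<rho>: "\<And>x. x \<in> carrier G \<Longrightarrow> \<rho> x \<in> R"
    and \<sigma>: "\<And>x. x \<in> carrier G \<Longrightarrow> \<sigma> x \<in> S"
    and \<epsilon>: "\<And>x. x \<in> carrier G \<Longrightarrow> \<epsilon> x \<in> ?A"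
    and decomp: "\<And>x. x \<in> carrier G \<Longrightarrow> x = \<gamma> x \<otimes> \<rho> x \<otimes> \<sigma> x \<otimes> \<epsilon> x"
    and r: "\<And>x r. x \<in> carrier G \<Longrightarrow> r \<in> R \<Longrightarrow> \<gamma> (x \<otimes> r) = \<gamma> x \<and> \<sigma> (x \<otimes> r) = \<sigma> x"
    and s: "\<And>x s. x \<in> carrier G \<Longrightarrow> s \<in> S \<Longrightarrow> \<gamma> (x \<otimes> s) = \<gamma> x \<and> \<rho> (x \<otimes> s) = \<rho> x"
    by (rule transversal[OF R S]) blast
  define \<phi> where "\<phi> x = \<pi> (\<epsilon> x)" for x
  define M where "M = H\<lparr>carrier := \<pi> ` ?A\<rparr>"
  have M_mult: "x \<otimes>\<^bsub>M\<^esub> y = x \<otimes>\<^bsub>H\<^esub> y" for x y by (simp add: M_def)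
  have "group M"
    unfolding M_def using H.subgroup_imp_group[OF \<pi>.subgroup_img_is_subgroup[OF A]] .
  then have M: "comm_group M"
    by (rule group.group_comm_groupI) (auto simp: M_def comm_RS)
  have \<phi>_closed: "\<phi> ` carrier G \<subseteq> carrier M" unfolding \<phi>_def M_def using \<epsilon> by auto
  have comm_\<phi>: "\<phi> x \<otimes>\<^bsub>H\<^esub> \<phi> y = \<phi> y \<otimes>\<^bsub>H\<^esub> \<phi> x" if "x \<in> carrier G" "y \<in> carrier G" for x y
    using comm_RS[of "\<epsilon> x" "\<epsilon> y"] \<epsilon> that unfolding \<phi>_def by blast
  have \<phi>_H: "\<phi> x \<in> carrier H" if "x \<in> carrier G" for x
    using Ac[OF \<epsilon>[OF that]] by (simp add: \<phi>_def)
  have \<phi>_A: "\<phi> (x \<otimes> a) = \<phi> x \<otimes>\<^bsub>H\<^esub> \<pi> a" if x: "x \<in> carrier G" and a: "a \<in> ?A" for x a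
  proof -
    let ?y = "\<gamma> x \<otimes> \<rho> x \<otimes> \<sigma> x"
    have c: "?y \<in> carrier G" "\<epsilon> x \<in> carrier G" "\<epsilon> (x \<otimes> a) \<in> carrier G" "a \<in> carrier G"
      using \<gamma> \<rho> \<sigma> \<epsilon> x Ac a by auto
    have "?y \<otimes> \<epsilon> (x \<otimes> a) = x \<otimes> a"
      using decomp[of "x \<otimes> a"] r[of x a] s[of x a] x a c(4) by simp
    also have "\<dots> = ?y \<otimes> (\<epsilon> x \<otimes> a)"
      using decomp[OF x] c by (simp flip: m_assoc)
    finally have "\<epsilon> (x \<otimes> a) = \<epsilon> x \<otimes> a" using c by (simp del: m_assoc)
    then show ?thesis using c by (simp add: \<phi>_def)
  qed
  \<comment> \<open>\<open>hba = hab[b\<inverse>,a\<inverse>]\<close>, and \<open>\<pi>\<close> kills the commutator.\<close>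
  have swap: "\<phi> (h \<otimes> b \<otimes> a) = \<phi> (h \<otimes> a \<otimes> b)"
    if c: "h \<in> carrier G" "a \<in> carrier G" "b \<in> carrier G"
      and k: "inv b \<otimes> inv a \<otimes> b \<otimes> a \<in> ?A" and comm: "\<pi> a \<otimes>\<^bsub>H\<^esub> \<pi> b = \<pi> b \<otimes>\<^bsub>H\<^esub> \<pi> a" for h a b
  proof -
    have "h \<otimes> b \<otimes> a = h \<otimes> a \<otimes> b \<otimes> (inv b \<otimes> inv a \<otimes> b \<otimes> a)"
      using c by (simp add: m_assoc inv_mult_cancel)
    moreover have "\<pi> (inv b \<otimes> inv a \<otimes> b \<otimes> a) = \<one>\<^bsub>H\<^esub>"
      using c comm by (simp add: H.m_assoc H.inv_mult_cancel flip: comm)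
    ultimately show ?thesis using \<phi>_A[OF _ k, of "h \<otimes> a \<otimes> b"] c \<phi>_H by simp
  qed
  have RS: "\<phi> (h \<otimes> a \<otimes> b) \<otimes>\<^bsub>H\<^esub> \<phi> h = \<phi> (h \<otimes> a) \<otimes>\<^bsub>H\<^esub> \<phi> (h \<otimes> b)"
    if h: "h \<in> carrier G" and a: "a \<in> R" and b: "b \<in> S" for h a b
  proof -
    note c = h R.mem_carrier[OF a] S.mem_carrier[OF b]
    have dec: "\<pi> x = \<pi> (\<gamma> x) \<otimes>\<^bsub>H\<^esub> \<pi> (\<rho> x) \<otimes>\<^bsub>H\<^esub> \<pi> (\<sigma> x) \<otimes>\<^bsub>H\<^esub> \<phi> x" if x: "x \<in> carrier G" for x
    proof -
      have "\<pi> x = \<pi> (\<gamma> x \<otimes> \<rho> x \<otimes> \<sigma> x \<otimes> \<epsilon> x)" using decomp[OF x] by (rule arg_cong)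
      then show ?thesis
        using \<gamma>[OF x] R.mem_carrier[OF \<rho>[OF x]] S.mem_carrier[OF \<sigma>[OF x]] Ac[OF \<epsilon>[OF x]]
        by (simp add: \<phi>_def)
    qed
    \<comment> \<open>Moving \<open>a\<close> past \<open>b\<close> exhibits \<open>hab\<close> in the coset of \<open>hb\<close> modulo \<open>R\<close>, which determines \<open>\<sigma>\<close>.\<close>
    obtain r' where r': "r' \<in> R" "a \<otimes> b = b \<otimes> r'"
      using normal_mult_swap[OF R a c(3)] .
    have hab: "h \<otimes> a \<otimes> b = h \<otimes> b \<otimes> r'"
      using r' c R.mem_carrier[OF r'(1)] by (simp add: m_assoc)
    have \<gamma>': "\<gamma> (h \<otimes> a) = \<gamma> h" "\<gamma> (h \<otimes> b) = \<gamma> h" "\<gamma> (h \<otimes> a \<otimes> b) = \<gamma> h"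
      using r[OF h a] s[OF h b] s[of "h \<otimes> a" b] b c by auto
    have \<rho>': "\<rho> (h \<otimes> b) = \<rho> h" "\<rho> (h \<otimes> a \<otimes> b) = \<rho> (h \<otimes> a)"
      using s[OF h b] s[of "h \<otimes> a" b] b c by auto
    have \<sigma>': "\<sigma> (h \<otimes> a) = \<sigma> h" "\<sigma> (h \<otimes> a \<otimes> b) = \<sigma> (h \<otimes> b)"
      using r[OF h a] r[of "h \<otimes> b" r'] r'(1) c by (auto simp: hab)
    show ?thesis
    proof (rule H.commuting_coordinates[where P = "\<pi> ` R" and Q = "\<pi> ` S" and g = "\<pi> (\<gamma> h)"
          and x = "\<pi> h" and r = "\<pi> a" and s = "\<pi> b" and ?r0.0 = "\<pi> (\<rho> h)" and ?s0.0 = "\<pi> (\<sigma> h)"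
          and ?r1.0 = "\<pi> (\<rho> (h \<otimes> a))" and ?s1.0 = "\<pi> (\<sigma> (h \<otimes> b))"])
      show "\<pi> ` R \<subseteq> carrier H" "\<pi> ` S \<subseteq> carrier H"
        using R.subset S.subset by auto
      show "x \<otimes>\<^bsub>H\<^esub> y = y \<otimes>\<^bsub>H\<^esub> x" if "x \<in> \<pi> ` R" "y \<in> \<pi> ` S" for x y
        using that comm_RS by blast
      show "\<pi> a \<in> \<pi> ` R" "\<pi> (\<rho> h) \<in> \<pi> ` R" "\<pi> (\<rho> (h \<otimes> a)) \<in> \<pi> ` R"
        "\<pi> b \<in> \<pi> ` S" "\<pi> (\<sigma> h) \<in> \<pi> ` S" "\<pi> (\<sigma> (h \<otimes> b)) \<in> \<pi> ` S"
        using a b \<rho> \<sigma> c by auto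
      show "\<phi> h \<in> \<pi> ` R \<inter> \<pi> ` S" "\<phi> (h \<otimes> a) \<in> \<pi> ` R \<inter> \<pi> ` S" "\<phi> (h \<otimes> b) \<in> \<pi> ` R \<inter> \<pi> ` S"
        "\<phi> (h \<otimes> a \<otimes> b) \<in> \<pi> ` R \<inter> \<pi> ` S"
        unfolding \<phi>_def using \<epsilon> c by auto
      show "\<pi> (\<gamma> h) \<in> carrier H" using \<gamma> h by simp
      show "\<pi> (\<gamma> h) \<otimes>\<^bsub>H\<^esub> \<pi> (\<rho> h) \<otimes>\<^bsub>H\<^esub> \<pi> (\<sigma> h) \<otimes>\<^bsub>H\<^esub> \<phi> h = \<pi> h"
        using dec[OF h] by simp
      show "\<pi> (\<gamma> h) \<otimes>\<^bsub>H\<^esub> \<pi> (\<rho> (h \<otimes> a)) \<otimes>\<^bsub>H\<^esub> \<pi> (\<sigma> h) \<otimes>\<^bsub>H\<^esub> \<phi> (h \<otimes> a) = \<pi> h \<otimes>\<^bsub>H\<^esub> \<pi> a"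
        using dec[of "h \<otimes> a"] c by (simp add: \<gamma>' \<sigma>')
      show "\<pi> (\<gamma> h) \<otimes>\<^bsub>H\<^esub> \<pi> (\<rho> h) \<otimes>\<^bsub>H\<^esub> \<pi> (\<sigma> (h \<otimes> b)) \<otimes>\<^bsub>H\<^esub> \<phi> (h \<otimes> b) = \<pi> h \<otimes>\<^bsub>H\<^esub> \<pi> b"
        using dec[of "h \<otimes> b"] c by (simp add: \<gamma>' \<rho>')
      show "\<pi> (\<gamma> h) \<otimes>\<^bsub>H\<^esub> \<pi> (\<rho> (h \<otimes> a)) \<otimes>\<^bsub>H\<^esub> \<pi> (\<sigma> (h \<otimes> b)) \<otimes>\<^bsub>H\<^esub> \<phi> (h \<otimes> a \<otimes> b)
          = \<pi> h \<otimes>\<^bsub>H\<^esub> \<pi> a \<otimes>\<^bsub>H\<^esub> \<pi> b"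
        using dec[of "h \<otimes> a \<otimes> b"] c by (simp add: \<gamma>' \<rho>' \<sigma>')
    qed
  qed
  have AT: "\<phi> (h \<otimes> a \<otimes> t) \<otimes>\<^bsub>H\<^esub> \<phi> h = \<phi> (h \<otimes> a) \<otimes>\<^bsub>H\<^esub> \<phi> (h \<otimes> t)"
    if h: "h \<in> carrier G" and a: "a \<in> ?A" and t: "t \<in> T" for h a t
  proof -
    note c = h Ac[OF a] subsetD[OF T t]
    have a': "inv t \<otimes> a \<otimes> t \<in> ?A"
      using R.inv_op_closed1[of t a] S.inv_op_closed1[of t a] a c by blast
    have "\<phi> (h \<otimes> a \<otimes> t) = \<phi> (h \<otimes> t \<otimes> (inv t \<otimes> a \<otimes> t))"
      using c by (simp add: m_assoc inv_mult_cancel)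
    also have "\<dots> = \<phi> (h \<otimes> t) \<otimes>\<^bsub>H\<^esub> \<pi> (inv t \<otimes> a \<otimes> t)"
      using \<phi>_A[OF _ a'] c by simp
    also have "\<pi> (inv t \<otimes> a \<otimes> t) = \<pi> a"
      using c comm_T[OF a t] by (simp add: H.m_assoc H.inv_mult_cancel)
    finally have 1: "\<phi> (h \<otimes> a \<otimes> t) = \<phi> (h \<otimes> t) \<otimes>\<^bsub>H\<^esub> \<pi> a" .
    have 2: "\<phi> (h \<otimes> a) = \<phi> h \<otimes>\<^bsub>H\<^esub> \<pi> a" using \<phi>_A[OF h a] .
    have "\<pi> a \<otimes>\<^bsub>H\<^esub> \<phi> h = \<phi> h \<otimes>\<^bsub>H\<^esub> \<pi> a"
      unfolding \<phi>_def using comm_RS[of a "\<epsilon> h"] a \<epsilon>[OF h] by blast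
    then have "\<phi> (h \<otimes> a \<otimes> t) \<otimes>\<^bsub>H\<^esub> \<phi> h = \<phi> (h \<otimes> t) \<otimes>\<^bsub>H\<^esub> \<phi> (h \<otimes> a)"
      using c \<phi>_H by (simp add: 1 2 H.m_assoc)
    also have "\<dots> = \<phi> (h \<otimes> a) \<otimes>\<^bsub>H\<^esub> \<phi> (h \<otimes> t)" using comm_\<phi> c by simp
    finally show ?thesis .
  qed
  have SR: "\<phi> (h \<otimes> b \<otimes> a) \<otimes>\<^bsub>H\<^esub> \<phi> h = \<phi> (h \<otimes> b) \<otimes>\<^bsub>H\<^esub> \<phi> (h \<otimes> a)"
    if h: "h \<in> carrier G" and a: "a \<in> R" and b: "b \<in> S" for h a b
  proof -
    note c = h R.mem_carrier[OF a] S.mem_carrier[OF b]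
    have "inv b \<otimes> inv a \<otimes> b \<otimes> a \<in> R"
      using R.inv_op_closed1[OF c(3) R.m_inv_closed[OF a]] a by blast
    moreover have "inv b \<otimes> (inv a \<otimes> b \<otimes> a) \<in> S"
      using S.inv_op_closed1[OF c(2) b] b by blast
    ultimately have "inv b \<otimes> inv a \<otimes> b \<otimes> a \<in> ?A" using c by (simp add: m_assoc)
    from swap[OF c this comm_RS[OF a b]] show ?thesis
      using RS[OF h a b] comm_\<phi> c by simp
  qed
  have TA: "\<phi> (h \<otimes> t \<otimes> a) \<otimes>\<^bsub>H\<^esub> \<phi> h = \<phi> (h \<otimes> t) \<otimes>\<^bsub>H\<^esub> \<phi> (h \<otimes> a)"
    if h: "h \<in> carrier G" and a: "a \<in> ?A" and t: "t \<in> T" for h a t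
  proof -
    note c = h Ac[OF a] subsetD[OF T t]
    have "inv t \<otimes> inv a \<otimes> t \<otimes> a \<in> ?A"
      using R.inv_op_closed1[of t "inv a"] S.inv_op_closed1[of t "inv a"] a c by blast
    from swap[OF c this comm_T[OF a t]] show ?thesis
      using AT[OF h a t] comm_\<phi> c by simp
  qed
  obtain W where W: "frag.subspace W"
    and W2: "\<And>x y. x \<in> carrier G \<Longrightarrow> y \<in> carrier G \<Longrightarrow> frag_of x - frag_of y \<in> W \<longleftrightarrow> \<phi> x = \<phi> y"
    and W4: "\<And>x y z w. x \<in> carrier G \<Longrightarrow> y \<in> carrier G \<Longrightarrow> z \<in> carrier G \<Longrightarrow> w \<in> carrier G \<Longrightarrow>
      frag_of x - frag_of y - frag_of z + frag_of w \<in> W \<longleftrightarrow> \<phi> x \<otimes>\<^bsub>M\<^esub> \<phi> w = \<phi> y \<otimes>\<^bsub>M\<^esub> \<phi> z"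
    by (rule additive_extension_kernel[OF M \<phi>_closed]) blast
  have "frag.span (second_diffs G R S \<union> second_diffs G S R
      \<union> second_diffs G ?A T \<union> second_diffs G T ?A) \<subseteq> W"
  proof (rule frag.span_minimal[OF _ W], intro Un_least)
    show "second_diffs G R S \<subseteq> W" "second_diffs G S R \<subseteq> W"
      using RS SR R.mem_carrier S.mem_carrier by (auto simp: second_diffs_def W4 M_mult)
    show "second_diffs G ?A T \<subseteq> W" "second_diffs G T ?A \<subseteq> W"
      using AT TA Ac subsetD[OF T] by (auto simp: second_diffs_def W4 M_mult)
  qed
  then have "\<phi> g = \<phi> \<one>" using diff W2[of g \<one>] Ac[OF g] by blast
  moreover have "\<phi> g = \<phi> \<one> \<otimes>\<^bsub>H\<^esub> \<pi> g" using \<phi>_A[OF one_closed g] Ac[OF g] by simp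
  ultimately show ?thesis
    using \<phi>_H[OF one_closed] Ac[OF g] by simp
qed


section \<open>Additive generators of the products\<close>

text \<open>\<open>g(a - 1) \<cdot> h(b - 1) = gh(a' - 1)(b - 1)\<close> with \<open>a' = h\<inverse>ah\<close>.\<close>
lemma coset_diffs_mult:
  assumes A: "A \<lhd> G" and B: "B \<subseteq> carrier G" and x: "x \<in> coset_diffs G A" and y: "y \<in> coset_diffs G B"
  shows "x \<otimes>\<^bsub>group_ring G\<^esub> y \<in> second_diffs G A B"
proof -
  interpret A: normal A G by fact
  obtain g a where g: "g \<in> carrier G" "a \<in> A" "x = frag_of (g \<otimes> a) - frag_of g"
    using x by (auto simp: coset_diffs_def)
  obtain h b where h: "h \<in> carrier G" "b \<in> B" "y = frag_of (h \<otimes> b) - frag_of h"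
    using y by (auto simp: coset_diffs_def)
  obtain a' where a': "a' \<in> A" "a \<otimes> h = h \<otimes> a'" using normal_mult_swap[OF A g(2) h(1)] .
  note c = g(1) h(1) A.mem_carrier[OF g(2)] A.mem_carrier[OF a'(1)] subsetD[OF B h(2)]
  have "a \<otimes> (h \<otimes> b) = h \<otimes> (a' \<otimes> b)" using a'(2) c by (simp flip: m_assoc)
  then have "x \<otimes>\<^bsub>group_ring G\<^esub> y =
      frag_of (g \<otimes> h \<otimes> a' \<otimes> b) - frag_of (g \<otimes> h \<otimes> a') - frag_of (g \<otimes> h \<otimes> b) + frag_of (g \<otimes> h)"
    using a'(2) c by (simp add: g(3) h(3) frag_extend_diff m_assoc algebra_simps)
  then show ?thesis using second_diffsI[OF m_closed[OF g(1) h(1)] a'(1) h(2)] by (simp only:)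
qed

lemma second_diffs_mult_left:
  assumes "A \<subseteq> carrier G" "B \<subseteq> carrier G" and h: "h \<in> carrier G" and q: "q \<in> second_diffs G A B"
  shows "frag_of h \<otimes>\<^bsub>group_ring G\<^esub> q \<in> second_diffs G A B"
proof -
  obtain g a b where g: "g \<in> carrier G" "a \<in> A" "b \<in> B"
    "q = frag_of (g \<otimes> a \<otimes> b) - frag_of (g \<otimes> a) - frag_of (g \<otimes> b) + frag_of g"
    using q by (auto simp: second_diffs_def)
  have "frag_of h \<otimes>\<^bsub>group_ring G\<^esub> q = frag_of (h \<otimes> g \<otimes> a \<otimes> b) - frag_of (h \<otimes> g \<otimes> a)
      - frag_of (h \<otimes> g \<otimes> b) + frag_of (h \<otimes> g)"
    using assms g by (simp add: frag_extend_diff frag_extend_add m_assoc subset_iff)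
  then show ?thesis using second_diffsI[OF m_closed[OF h g(1)] g(2,3)] by (simp only:)
qed

lemma second_diffs_mult_right:
  assumes A: "A \<lhd> G" and B: "B \<lhd> G" and h: "h \<in> carrier G" and q: "q \<in> second_diffs G A B"
  shows "q \<otimes>\<^bsub>group_ring G\<^esub> frag_of h \<in> second_diffs G A B"
proof -
  interpret A: normal A G by fact
  interpret B: normal B G by fact
  obtain g a b where g: "g \<in> carrier G" "a \<in> A" "b \<in> B"
    "q = frag_of (g \<otimes> a \<otimes> b) - frag_of (g \<otimes> a) - frag_of (g \<otimes> b) + frag_of g"
    using q by (auto simp: second_diffs_def)
  obtain a' where a': "a' \<in> A" "a \<otimes> h = h \<otimes> a'" using normal_mult_swap[OF A g(2) h] .
  obtain b' where b': "b' \<in> B" "b \<otimes> h = h \<otimes> b'" using normal_mult_swap[OF B g(3) h] .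
  note c = g(1) h A.mem_carrier[OF g(2)] A.mem_carrier[OF a'(1)]
    B.mem_carrier[OF g(3)] B.mem_carrier[OF b'(1)]
  have "a \<otimes> (h \<otimes> b') = h \<otimes> (a' \<otimes> b')" using a'(2) c by (simp flip: m_assoc)
  then have "q \<otimes>\<^bsub>group_ring G\<^esub> frag_of h = frag_of (g \<otimes> h \<otimes> a' \<otimes> b') - frag_of (g \<otimes> h \<otimes> a')
      - frag_of (g \<otimes> h \<otimes> b') + frag_of (g \<otimes> h)"
    using a'(2) b'(2) c by (simp add: g(4) frag_extend_diff frag_extend_add m_assoc)
  then show ?thesis using second_diffsI[OF m_closed[OF g(1) h] a'(1) b'(1)] by (simp only:)
qed

text \<open>
  In the last two products, a generator of \<open>\<rr> \<inter> \<ss>\<close> is either a second difference for \<open>(R,S)\<close>, and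
  remains one after multiplication by group elements, or an element \<open>g(a - 1)\<close> with \<open>a \<in> R \<inter> S\<close>,
  which yields second differences with \<open>T\<close>.
\<close>
lemma ideal_sum_subset_span:
  assumes R: "R \<lhd> G" and S: "S \<lhd> G" and T: "T \<lhd> G"
  defines "\<rr> \<equiv> relative_augmentation_ideal G R"
    and "\<ss> \<equiv> relative_augmentation_ideal G S"
    and "\<tt> \<equiv> relative_augmentation_ideal G T"
  shows "(\<rr> \<cdot>\<^bsub>group_ring G\<^esub> \<ss>) <+>\<^bsub>group_ring G\<^esub> (\<ss> \<cdot>\<^bsub>group_ring G\<^esub> \<rr>)
      <+>\<^bsub>group_ring G\<^esub> ((\<rr> \<inter> \<ss>) \<cdot>\<^bsub>group_ring G\<^esub> \<tt>)
      <+>\<^bsub>group_ring G\<^esub> (\<tt> \<cdot>\<^bsub>group_ring G\<^esub> (\<rr> \<inter> \<ss>))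
    \<subseteq> frag.span (second_diffs G R S \<union> second_diffs G S R
      \<union> second_diffs G (R \<inter> S) T \<union> second_diffs G T (R \<inter> S))"
    (is "_ \<subseteq> frag.span ?D")
proof -
  interpret R: normal R G by fact
  interpret S: normal S G by fact
  interpret T: normal T G by fact
  have A: "R \<inter> S \<lhd> G" using normal_subgroup_intersect[OF R S] .
  note W = frag.subspace_span[of ?D]
  have rs: "\<rr> \<cdot>\<^bsub>group_ring G\<^esub> \<ss> \<subseteq> frag.span ?D"
    unfolding \<rr>_def \<ss>_def relative_augmentation_ideal_eq_span[OF R] relative_augmentation_ideal_eq_span[OF S]
    by (rule ideal_prod_subset_subspace[OF W order_refl order_refl], rule frag.span_base)
      (use coset_diffs_mult[OF R S.subset] in blast)
  have sr: "\<ss> \<cdot>\<^bsub>group_ring G\<^esub> \<rr> \<subseteq> frag.span ?D"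
    unfolding \<rr>_def \<ss>_def relative_augmentation_ideal_eq_span[OF R] relative_augmentation_ideal_eq_span[OF S]
    by (rule ideal_prod_subset_subspace[OF W order_refl order_refl], rule frag.span_base)
      (use coset_diffs_mult[OF S R.subset] in blast)
  have inter: "\<rr> \<inter> \<ss> \<subseteq> frag.span (second_diffs G R S \<union> coset_diffs G (R \<inter> S))"
    unfolding \<rr>_def \<ss>_def by (rule ideal_inter_subset_span[OF R S])
  have t: "\<tt> \<subseteq> frag.span (coset_diffs G T)"
    unfolding \<tt>_def by (simp add: relative_augmentation_ideal_eq_span[OF T])
  have inter_t: "(\<rr> \<inter> \<ss>) \<cdot>\<^bsub>group_ring G\<^esub> \<tt> \<subseteq> frag.span ?D"
  proof (rule ideal_prod_subset_subspace[OF W inter t])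
    fix x y assume x: "x \<in> second_diffs G R S \<union> coset_diffs G (R \<inter> S)" and y: "y \<in> coset_diffs G T"
    from x show "x \<otimes>\<^bsub>group_ring G\<^esub> y \<in> frag.span ?D"
    proof
      assume x: "x \<in> second_diffs G R S"
      obtain h h' where h: "h \<in> carrier G" "h' \<in> carrier G" "y = frag_of h' - frag_of h"
        using y T.mem_carrier m_closed unfolding coset_diffs_def by blast
      have "x \<otimes>\<^bsub>group_ring G\<^esub> y = x \<otimes>\<^bsub>group_ring G\<^esub> frag_of h' - x \<otimes>\<^bsub>group_ring G\<^esub> frag_of h"
        by (simp add: h(3) frag_extend_diff frag_extend_fun_diff)
      moreover have "x \<otimes>\<^bsub>group_ring G\<^esub> frag_of h' - x \<otimes>\<^bsub>group_ring G\<^esub> frag_of h \<in> frag.span ?D"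
        using second_diffs_mult_right[OF R S h(1) x] second_diffs_mult_right[OF R S h(2) x]
        by (intro frag.span_diff frag.span_base) blast+
      ultimately show ?thesis by (simp only:)
    next
      assume "x \<in> coset_diffs G (R \<inter> S)"
      from coset_diffs_mult[OF A T.subset this y] show ?thesis by (intro frag.span_base) blast
    qed
  qed
  have t_inter: "\<tt> \<cdot>\<^bsub>group_ring G\<^esub> (\<rr> \<inter> \<ss>) \<subseteq> frag.span ?D"
  proof (rule ideal_prod_subset_subspace[OF W t inter])
    fix x y assume x: "x \<in> coset_diffs G T" and y: "y \<in> second_diffs G R S \<union> coset_diffs G (R \<inter> S)"
    from y show "x \<otimes>\<^bsub>group_ring G\<^esub> y \<in> frag.span ?D"
    proof
      assume y: "y \<in> second_diffs G R S"
      obtain h h' where h: "h \<in> carrier G" "h' \<in> carrier G" "x = frag_of h' - frag_of h"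
        using x T.mem_carrier m_closed unfolding coset_diffs_def by blast
      have "x \<otimes>\<^bsub>group_ring G\<^esub> y = frag_of h' \<otimes>\<^bsub>group_ring G\<^esub> y - frag_of h \<otimes>\<^bsub>group_ring G\<^esub> y"
        by (simp add: h(3) frag_extend_diff)
      moreover have "frag_of h' \<otimes>\<^bsub>group_ring G\<^esub> y - frag_of h \<otimes>\<^bsub>group_ring G\<^esub> y \<in> frag.span ?D"
        using second_diffs_mult_left[OF R.subset S.subset h(1) y]
          second_diffs_mult_left[OF R.subset S.subset h(2) y]
        by (intro frag.span_diff frag.span_base) blast+
      ultimately show ?thesis by (simp only:)
    next
      assume "y \<in> coset_diffs G (R \<inter> S)"
      from coset_diffs_mult[OF T _ x this] show ?thesis
        using R.subset by (intro frag.span_base) blast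
    qed
  qed
  show ?thesis
    by (intro set_add_subset_subspace[OF W] rs sr inter_t t_inter)
qed

section \<open>Commutators and ideals\<close>

text \<open>Closure under products comes from \<open>gh - 1 = (g - 1)h + (h - 1)\<close>, under inverses from \<open>g\<inverse> - 1 = - (g - 1)g\<inverse>\<close>.\<close>
lemma subgroup_ideal_subgroup:
  assumes "ideal J (group_ring G)"
  shows "subgroup (ideal_subgroup G J) G"
proof
  interpret J: ideal J "group_ring G" by fact
  note subspace = ideal_group_ring_subspace[OF group_axioms assms]
  show "ideal_subgroup G J \<subseteq> carrier G" by (auto simp: ideal_subgroup_def)
  show "\<one> \<in> ideal_subgroup G J"
    using frag.subspace_0[OF subspace] by (simp add: ideal_subgroup_def)
  have mult: "frag_of (g \<otimes> h) - frag_of h \<in> J"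
    if g: "g \<in> carrier G" "frag_of g - frag_of \<one> \<in> J" and h: "h \<in> carrier G" for g h
  proof -
    have "frag_of (g \<otimes> h) - frag_of h = (frag_of g - frag_of \<one>) \<otimes>\<^bsub>group_ring G\<^esub> frag_of h"
      using g h by (simp add: frag_extend_diff)
    also have "\<dots> \<in> J" using g(2) h by (intro J.I_r_closed) auto
    finally show ?thesis .
  qed
  fix g assume "g \<in> ideal_subgroup G J"
  then have g: "g \<in> carrier G" "frag_of g - frag_of \<one> \<in> J" by (auto simp: ideal_subgroup_def)
  show "inv g \<in> ideal_subgroup G J"
    using frag.subspace_neg[OF subspace mult[OF g inv_closed[OF g(1)]]] g
    by (simp add: ideal_subgroup_def)
  fix h assume "h \<in> ideal_subgroup G J"
  then have h: "h \<in> carrier G" "frag_of h - frag_of \<one> \<in> J" by (auto simp: ideal_subgroup_def)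
  show "g \<otimes> h \<in> ideal_subgroup G J"
    using frag.subspace_add[OF subspace mult[OF g h(1)] h(2)] g h
    by (simp add: ideal_subgroup_def)
qed

text \<open>
  \<open>(a - 1)(b - 1) - (b - 1)(a - 1) = ab - ba = ([a,b] - 1)ba\<close>, and \<open>ba\<close> is a unit.
\<close>
lemma commutator_subgroup_subset_ideal_subgroup:
  assumes J: "ideal J (group_ring G)" and A: "A \<subseteq> carrier G" and B: "B \<subseteq> carrier G"
    and P: "\<And>a. a \<in> A \<Longrightarrow> frag_of a - frag_of \<one> \<in> P"
    and Q: "\<And>b. b \<in> B \<Longrightarrow> frag_of b - frag_of \<one> \<in> Q"
    and PQ: "P \<cdot>\<^bsub>group_ring G\<^esub> Q \<subseteq> J" and QP: "Q \<cdot>\<^bsub>group_ring G\<^esub> P \<subseteq> J"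
  shows "commutator_subgroup G A B \<subseteq> ideal_subgroup G J"
  unfolding commutator_subgroup_def
proof (rule generate_subgroup_incl[OF _ subgroup_ideal_subgroup[OF J]], safe)
  interpret J: ideal J "group_ring G" by fact
  note subspace = ideal_group_ring_subspace[OF group_axioms J]
  fix a b assume a: "a \<in> A" and b: "b \<in> B"
  have c: "a \<in> carrier G" "b \<in> carrier G" using a b A B by auto
  let ?a = "frag_of a - frag_of \<one>" and ?b = "frag_of b - frag_of \<one>"
  have ab: "?a \<otimes>\<^bsub>group_ring G\<^esub> ?b - ?b \<otimes>\<^bsub>group_ring G\<^esub> ?a \<in> J"
    using ideal_prod.prod[OF P[OF a] Q[OF b]] ideal_prod.prod[OF Q[OF b] P[OF a]] PQ QP
    by (intro frag.subspace_diff[OF subspace]) blast+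
  have "?a \<otimes>\<^bsub>group_ring G\<^esub> ?b - ?b \<otimes>\<^bsub>group_ring G\<^esub> ?a = frag_of (a \<otimes> b) - frag_of (b \<otimes> a)"
    using c by (simp add: frag_extend_diff)
  moreover have "(frag_of (a \<otimes> b) - frag_of (b \<otimes> a)) \<otimes>\<^bsub>group_ring G\<^esub> frag_of (inv a \<otimes> inv b)
      = frag_of (a \<otimes> b \<otimes> inv a \<otimes> inv b) - frag_of \<one>"
    using c by (simp add: frag_extend_diff m_assoc inv_mult_cancel)
  moreover have "(?a \<otimes>\<^bsub>group_ring G\<^esub> ?b - ?b \<otimes>\<^bsub>group_ring G\<^esub> ?a) \<otimes>\<^bsub>group_ring G\<^esub> frag_of (inv a \<otimes> inv b) \<in> J"
    using ab c by (intro J.I_r_closed) auto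
  ultimately have "frag_of (a \<otimes> b \<otimes> inv a \<otimes> inv b) - frag_of \<one> \<in> J" by (simp only:)
  then show "a \<otimes> b \<otimes> inv a \<otimes> inv b \<in> ideal_subgroup G J"
    using c by (simp add: ideal_subgroup_def)
qed

lemma conj_mult:
  assumes "g \<in> carrier G" "x \<in> carrier G" "y \<in> carrier G"
  shows "g \<otimes> (x \<otimes> y) \<otimes> inv g = (g \<otimes> x \<otimes> inv g) \<otimes> (g \<otimes> y \<otimes> inv g)"
  using assms by (simp add: m_assoc inv_mult_cancel)

lemma commutator_subgroup_normal:
  assumes A: "A \<lhd> G" and B: "B \<lhd> G"
  shows "commutator_subgroup G A B \<lhd> G"
  unfolding commutator_subgroup_def
proof (rule normal_generateI)
  interpret A: normal A G by fact
  interpret B: normal B G by fact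
  show "(\<Union>a\<in>A. \<Union>b\<in>B. {a \<otimes> b \<otimes> inv a \<otimes> inv b}) \<subseteq> carrier G"
    using A.mem_carrier B.mem_carrier by auto
  fix x g assume "x \<in> (\<Union>a\<in>A. \<Union>b\<in>B. {a \<otimes> b \<otimes> inv a \<otimes> inv b})" and g: "g \<in> carrier G"
  then obtain a b where ab: "a \<in> A" "b \<in> B" "x = a \<otimes> b \<otimes> inv a \<otimes> inv b" by blast
  note c = g A.mem_carrier[OF ab(1)] B.mem_carrier[OF ab(2)]
  let ?a = "g \<otimes> a \<otimes> inv g" and ?b = "g \<otimes> b \<otimes> inv g"
  have "g \<otimes> x \<otimes> inv g = ?a \<otimes> ?b \<otimes> inv ?a \<otimes> inv ?b"
    using c by (simp add: ab(3) m_assoc inv_mult_group inv_mult_cancel)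
  moreover have "?a \<in> A" "?b \<in> B" using ab g A.inv_op_closed2 B.inv_op_closed2 by auto
  ultimately show "g \<otimes> x \<otimes> inv g \<in> (\<Union>a\<in>A. \<Union>b\<in>B. {a \<otimes> b \<otimes> inv a \<otimes> inv b})" by blast
qed

lemma normal_set_mult:
  assumes M: "M \<lhd> G" and N: "N \<lhd> G"
  shows "M <#> N \<lhd> G"
proof (rule normal_invI)
  interpret M: normal M G by fact
  interpret N: normal N G by fact
  show "subgroup (M <#> N) G" using mult_norm_subgroup[OF M N.is_subgroup] .
  fix g x assume g: "g \<in> carrier G" and "x \<in> M <#> N"
  then obtain m n where "m \<in> M" "n \<in> N" "x = m \<otimes> n" by (auto simp: set_mult_def)
  then show "g \<otimes> x \<otimes> inv g \<in> M <#> N"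
    using g M.inv_op_closed2 N.inv_op_closed2 M.mem_carrier N.mem_carrier conj_mult
    unfolding set_mult_def by auto blast
qed

lemma commute_Mod:
  assumes K: "K \<lhd> G" and c: "a \<in> carrier G" "b \<in> carrier G" and ab: "a \<otimes> b \<otimes> inv a \<otimes> inv b \<in> K"
  shows "(K #> a) \<otimes>\<^bsub>G Mod K\<^esub> (K #> b) = (K #> b) \<otimes>\<^bsub>G Mod K\<^esub> (K #> a)"
proof -
  interpret K: normal K G by fact
  have "a \<otimes> b = (a \<otimes> b \<otimes> inv a \<otimes> inv b) \<otimes> (b \<otimes> a)"
    using c by (simp add: m_assoc inv_mult_cancel)
  then have "a \<otimes> b \<in> K #> (b \<otimes> a)" using ab unfolding r_coset_def by blast
  then have "K #> (a \<otimes> b) = K #> (b \<otimes> a)"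
    using repr_independence[of "a \<otimes> b" K "b \<otimes> a"] c K.is_subgroup by simp
  then show ?thesis using c by (simp add: K.rcos_sum)
qed

end

theorem theorem9:
  fixes G :: "('a, 'b) monoid_scheme" and R S T :: "'a set"
    and \<rr> \<ss> \<tt> :: "('a \<Rightarrow>\<^sub>0 int) set"
  assumes "group G" and "R \<lhd> G" and "S \<lhd> G" and "T \<lhd> G"
  defines "\<rr> \<equiv> relative_augmentation_ideal G R"
    and "\<ss> \<equiv> relative_augmentation_ideal G S"
    and "\<tt> \<equiv> relative_augmentation_ideal G T"
  shows
    "ideal_subgroup G
       ((\<rr> \<cdot>\<^bsub>group_ring G\<^esub> \<ss>) <+>\<^bsub>group_ring G\<^esub> (\<ss> \<cdot>\<^bsub>group_ring G\<^esub> \<rr>)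
        <+>\<^bsub>group_ring G\<^esub> ((\<rr> \<inter> \<ss>) \<cdot>\<^bsub>group_ring G\<^esub> \<tt>)
        <+>\<^bsub>group_ring G\<^esub> (\<tt> \<cdot>\<^bsub>group_ring G\<^esub> (\<rr> \<inter> \<ss>)))
     = commutator_subgroup G R S <#>\<^bsub>G\<^esub> commutator_subgroup G (R \<inter> S) T"
    (is "ideal_subgroup G ?J = ?K")
proof
  interpret group G by fact
  interpret R: normal R G by fact
  interpret S: normal S G by fact
  interpret T: normal T G by fact
  interpret Z: ring "group_ring G" by (rule ring_group_ring) fact
  let ?A = "R \<inter> S"
  let ?rs = "\<rr> \<cdot>\<^bsub>group_ring G\<^esub> \<ss>" and ?sr = "\<ss> \<cdot>\<^bsub>group_ring G\<^esub> \<rr>"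
    and ?at = "(\<rr> \<inter> \<ss>) \<cdot>\<^bsub>group_ring G\<^esub> \<tt>" and ?ta = "\<tt> \<cdot>\<^bsub>group_ring G\<^esub> (\<rr> \<inter> \<ss>)"
  have ideals: "ideal \<rr> (group_ring G)" "ideal \<ss> (group_ring G)" "ideal \<tt> (group_ring G)"
    unfolding \<rr>_def \<ss>_def \<tt>_def
    by (intro relative_augmentation_ideal_ideal R.subset S.subset T.subset)+
  have inter: "ideal (\<rr> \<inter> \<ss>) (group_ring G)" using Z.i_intersect ideals by blast
  note prods = Z.ideal_prod_is_ideal[OF ideals(1,2)] Z.ideal_prod_is_ideal[OF ideals(2,1)]
    Z.ideal_prod_is_ideal[OF inter ideals(3)] Z.ideal_prod_is_ideal[OF ideals(3) inter]
  note J12 = Z.add_ideals[OF prods(1,2)]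
  note J123 = Z.add_ideals[OF J12 prods(3)]
  have J: "ideal ?J (group_ring G)" by (rule Z.add_ideals[OF J123 prods(4)])
  have summand: "I \<subseteq> I <+>\<^bsub>group_ring G\<^esub> I'" "I' \<subseteq> I <+>\<^bsub>group_ring G\<^esub> I'"
    if "ideal I (group_ring G)" "ideal I' (group_ring G)" for I I'
    using frag.subspace_0[OF ideal_group_ring_subspace[OF group_axioms that(1)]]
      frag.subspace_0[OF ideal_group_ring_subspace[OF group_axioms that(2)]]
    by (force simp: set_add_def')+
  have subs: "?rs \<subseteq> ?J" "?sr \<subseteq> ?J" "?at \<subseteq> ?J" "?ta \<subseteq> ?J"
    using summand[OF prods(1,2)] summand[OF J12 prods(3)] summand[OF J123 prods(4)] by blast+
  have r: "frag_of x - frag_of \<one>\<^bsub>G\<^esub> \<in> \<rr>" if "x \<in> R" for x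
    unfolding \<rr>_def using diff_one_in_relative_augmentation_ideal[OF R.subset that] .
  have s: "frag_of x - frag_of \<one>\<^bsub>G\<^esub> \<in> \<ss>" if "x \<in> S" for x
    unfolding \<ss>_def using diff_one_in_relative_augmentation_ideal[OF S.subset that] .
  have t: "frag_of x - frag_of \<one>\<^bsub>G\<^esub> \<in> \<tt>" if "x \<in> T" for x
    unfolding \<tt>_def using diff_one_in_relative_augmentation_ideal[OF T.subset that] .
  have K1: "commutator_subgroup G R S \<subseteq> ideal_subgroup G ?J"
    by (rule commutator_subgroup_subset_ideal_subgroup[OF J R.subset S.subset r s subs(1,2)])
  have K2: "commutator_subgroup G ?A T \<subseteq> ideal_subgroup G ?J"
    by (rule commutator_subgroup_subset_ideal_subgroup[OF J _ T.subset _ t subs(3,4)])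
      (use R.subset r s in auto)
  show "?K \<subseteq> ideal_subgroup G ?J"
  proof
    fix x assume "x \<in> ?K"
    then obtain y z where "y \<in> commutator_subgroup G R S" "z \<in> commutator_subgroup G ?A T"
      "x = y \<otimes>\<^bsub>G\<^esub> z" by (auto simp: set_mult_def)
    then show "x \<in> ideal_subgroup G ?J"
      using K1 K2 subgroup.m_closed[OF subgroup_ideal_subgroup[OF J]] by blast
  qed
  have A: "?A \<lhd> G" using normal_subgroup_intersect[OF assms(2,3)] .
  have N1: "commutator_subgroup G R S \<lhd> G" and N2: "commutator_subgroup G ?A T \<lhd> G"
    by (intro commutator_subgroup_normal assms A)+
  interpret N1: normal "commutator_subgroup G R S" G by fact
  interpret N2: normal "commutator_subgroup G ?A T" G by fact
  interpret K: normal ?K G by (rule normal_set_mult[OF N1 N2])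
  have N1K: "x \<in> ?K" if x: "x \<in> commutator_subgroup G R S" for x
  proof -
    have "x \<otimes>\<^bsub>G\<^esub> \<one>\<^bsub>G\<^esub> \<in> ?K" unfolding set_mult_def using x N2.one_closed by blast
    then show ?thesis using N1.mem_carrier[OF x] by simp
  qed
  have N2K: "x \<in> ?K" if x: "x \<in> commutator_subgroup G ?A T" for x
  proof -
    have "\<one>\<^bsub>G\<^esub> \<otimes>\<^bsub>G\<^esub> x \<in> ?K" unfolding set_mult_def using x N1.one_closed by blast
    then show ?thesis using N2.mem_carrier[OF x] by simp
  qed
  have comm: "x \<otimes>\<^bsub>G\<^esub> y \<otimes>\<^bsub>G\<^esub> inv\<^bsub>G\<^esub> x \<otimes>\<^bsub>G\<^esub> inv\<^bsub>G\<^esub> y \<in> commutator_subgroup G B C"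
    if "x \<in> B" "y \<in> C" for x y B C
    unfolding commutator_subgroup_def by (rule generate.incl) (use that in blast)
  show "ideal_subgroup G ?J \<subseteq> ?K"
  proof
    fix g assume "g \<in> ideal_subgroup G ?J"
    then have g: "g \<in> carrier G" and gJ: "frag_of g - frag_of \<one>\<^bsub>G\<^esub> \<in> ?J"
      by (auto simp: ideal_subgroup_def)
    have "?J \<subseteq> \<rr> \<inter> \<ss>"
    proof -
      note W = ideal_group_ring_subspace[OF group_axioms inter]
      have "?rs \<subseteq> \<rr> \<inter> \<ss>" "?sr \<subseteq> \<rr> \<inter> \<ss>" "?at \<subseteq> \<rr> \<inter> \<ss>" "?ta \<subseteq> \<rr> \<inter> \<ss>"
        using Z.ideal_prod_inter[OF ideals(1,2)] Z.ideal_prod_inter[OF ideals(2,1)]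
          Z.ideal_prod_inter[OF inter ideals(3)] Z.ideal_prod_inter[OF ideals(3) inter] by blast+
      then show ?thesis by (intro set_add_subset_subspace[OF W])
    qed
    then have gA: "g \<in> ?A"
      using ideal_subgroup_relative_augmentation_ideal[OF assms(2) g]
        ideal_subgroup_relative_augmentation_ideal[OF assms(3) g] gJ
      unfolding \<rr>_def \<ss>_def by blast
    have diff: "frag_of g - frag_of \<one>\<^bsub>G\<^esub> \<in> frag.span (second_diffs G R S \<union> second_diffs G S R
        \<union> second_diffs G ?A T \<union> second_diffs G T ?A)"
      using ideal_sum_subset_span[OF assms(2-4)] gJ unfolding \<rr>_def \<ss>_def \<tt>_def by blast
    have comm_RS: "(?K #>\<^bsub>G\<^esub> x) \<otimes>\<^bsub>G Mod ?K\<^esub> (?K #>\<^bsub>G\<^esub> y) = (?K #>\<^bsub>G\<^esub> y) \<otimes>\<^bsub>G Mod ?K\<^esub> (?K #>\<^bsub>G\<^esub> x)"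
      if "x \<in> R" "y \<in> S" for x y
      by (rule commute_Mod[OF K.normal_axioms R.mem_carrier[OF that(1)] S.mem_carrier[OF that(2)]
          N1K[OF comm[OF that]]])
    have comm_AT: "(?K #>\<^bsub>G\<^esub> x) \<otimes>\<^bsub>G Mod ?K\<^esub> (?K #>\<^bsub>G\<^esub> y) = (?K #>\<^bsub>G\<^esub> y) \<otimes>\<^bsub>G Mod ?K\<^esub> (?K #>\<^bsub>G\<^esub> x)"
      if x: "x \<in> ?A" and y: "y \<in> T" for x y
      by (rule commute_Mod[OF K.normal_axioms R.mem_carrier[OF IntD1[OF x]] T.mem_carrier[OF y]
          N2K[OF comm[OF x y]]])
    have "?K #>\<^bsub>G\<^esub> g = \<one>\<^bsub>G Mod ?K\<^esub>"
      by (rule trivial_image_of_span_second_diffs[OF K.factorgroup_is_group K.r_coset_hom_Mod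
          assms(2,3) T.subset comm_RS comm_AT gA diff])
    then have "?K #>\<^bsub>G\<^esub> g = ?K" by simp
    then show "g \<in> ?K" by (rule coset_join1[OF _ g K.is_subgroup])
  qed
qed

end
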